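(* Let $\alpha,\beta,\gamma>0$, $V>0$ and $c\in\mathbb{R}$ be constants. If $$-c+\gamma(1-\alpha)-2\beta V>0,$$ then, for all $\varepsilon>0$ sufficiently small, the dry friction oscillator with Stribeck effect $$\dot x_1=x_2,\qquad \dot x_2=-x_1-\varepsilon c\,x_2-\operatorname{sign}(x_2-V)\left(\frac{1-\alpha}{1+\varepsilon\gamma|x_2-V|}+\alpha+\varepsilon\beta(x_2-V)^2\right)$$ admits a finite-time stable stick-slip limit cycle $x_\varepsilon$ that passes through the point $(1-\varepsilon cV,\,V)$.
   Context: Here $V$ is the belt velocity, $c$ a viscous friction constant, and solutions are understood in the sense of Filippov. Filippov solution: for a planar system $\dot x=f(x)$ whose right-hand side is discontinuous only along the line $x_2=V$, put $f(x_1,V^-)=\lim_{x_2\to V-0}f(x_1,x_2)$ and $f(x_1,V^+)=\lim_{x_2\to V+0}f(x_1,x_2)$. A Filippov solution is an absolutely continuous function $x(t)$ with $\dot x(t)\in K[f](x(t))$ for almost every $t$, where $K[f](x)=\{f(x)\}$ if $x_2\neq V$ and $K[f](x_1,V)=\bigcup_{\lambda\in[0,1]}\{\lambda f(x_1,V^-)+(1-\lambda)f(x_1,V^+)\}$. A point $(x_1,V)$ is a point of sliding if the second component of $f(x_1,V^-)$ is positive and the second component of $f(x_1,V^+)$ is negative; for the system considered this is the segment $x_1\in(-1-\varepsilon cV,1-\varepsilon cV)$, on which the sliding motion is $\dot x_1=V$, $\dot x_2=0$. A limit cycle is an isolated closed orbit (the trajectory of a non-constant periodic Filippov solution). It is a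 stick-slip limit cycle if it contains both a sliding piece (a nondegenerate part of the sliding segment on $x_2=V$) and a piece outside the line $x_2=V$. It is finite-time stable if every solution starting sufficiently close to the cycle reaches the cycle in finite time and then stays on it. *)

theory Defs
  imports "HOL-Analysis.Analysis"
begin

text \<open>The library's \<open>absolutely_continuous\<close> is a relation between measures, so absolute
  continuity of a function is defined here. A division of its own union is a finite family of
  non-overlapping closed intervals.\<close>

definition absolutely_continuous_fun_on :: "real set \<Rightarrow> (real \<Rightarrow> 'a::real_normed_vector) \<Rightarrow> bool" where
  "absolutely_continuous_fun_on S x \<longleftrightarrow>
     (\<forall>e>0. \<exists>d>0. \<forall>P. P division_of \<Union>P \<and> \<Union>P \<subseteq> S \<and> (\<Sum>k\<in>P. Sup k - Inf k) < d
        \<longrightarrow> (\<Sum>k\<in>P. norm (x (Sup k) - x (Inf k))) < e)"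

definition lower_limit :: "real \<Rightarrow> (real \<times> real \<Rightarrow> real \<times> real) \<Rightarrow> real \<Rightarrow> real \<times> real" where
  "lower_limit V f x1 = Lim (at_left V) (\<lambda>x2. f (x1, x2))"

definition upper_limit :: "real \<Rightarrow> (real \<times> real \<Rightarrow> real \<times> real) \<Rightarrow> real \<Rightarrow> real \<times> real" where
  "upper_limit V f x1 = Lim (at_right V) (\<lambda>x2. f (x1, x2))"

definition filippov_map :: "real \<Rightarrow> (real \<times> real \<Rightarrow> real \<times> real) \<Rightarrow> real \<times> real \<Rightarrow> (real \<times> real) set" where
  "filippov_map V f p =
     (if snd p \<noteq> V then {f p}
      else (\<Union>l\<in>{0..1}. {l *\<^sub>R lower_limit V f (fst p) + (1 - l) *\<^sub>R upper_limit V f (fst p)}))"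

text \<open>On an unbounded interval, absolute continuity is meant on every compact subinterval.\<close>

definition filippov_solution_on ::
    "real \<Rightarrow> (real \<times> real \<Rightarrow> real \<times> real) \<Rightarrow> real set \<Rightarrow> (real \<Rightarrow> real \<times> real) \<Rightarrow> bool" where
  "filippov_solution_on V f J x \<longleftrightarrow>
     (\<forall>a b. {a..b} \<subseteq> J \<longrightarrow> absolutely_continuous_fun_on {a..b} x) \<and>
     (AE t in lebesgue. t \<in> J \<longrightarrow>
        (\<exists>v\<in>filippov_map V f (x t). (x has_vector_derivative v) (at t within J)))"

definition sliding_point :: "real \<Rightarrow> (real \<times> real \<Rightarrow> real \<times> real) \<Rightarrow> real \<times> real \<Rightarrow> bool" where
  "sliding_point V f p \<longleftrightarrow>
     snd p = V \<and> snd (lower_limit V f (fst p)) > 0 \<and> snd (upper_limit V f (fst p)) < 0"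

definition closed_orbit :: "real \<Rightarrow> (real \<times> real \<Rightarrow> real \<times> real) \<Rightarrow> (real \<times> real) set \<Rightarrow> bool" where
  "closed_orbit V f C \<longleftrightarrow>
     (\<exists>x T. filippov_solution_on V f UNIV x \<and> T > 0 \<and> (\<forall>t. x (t + T) = x t) \<and>
        \<not> x constant_on UNIV \<and> C = range x)"

text \<open>Isolated: no other closed orbit meets some metric neighbourhood of \<open>C\<close>; in particular none
  is contained in it.\<close>

definition limit_cycle :: "real \<Rightarrow> (real \<times> real \<Rightarrow> real \<times> real) \<Rightarrow> (real \<times> real) set \<Rightarrow> bool" where
  "limit_cycle V f C \<longleftrightarrow>
     closed_orbit V f C \<and>
     (\<exists>d>0. \<forall>D. closed_orbit V f D \<and> (\<exists>p\<in>D. \<exists>q\<in>C. dist p q < d) \<longrightarrow> D = C)"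

definition stick_slip :: "real \<Rightarrow> (real \<times> real \<Rightarrow> real \<times> real) \<Rightarrow> (real \<times> real) set \<Rightarrow> bool" where
  "stick_slip V f C \<longleftrightarrow>
     (\<exists>a b. a < b \<and> (\<forall>s\<in>{a..b}. (s, V) \<in> C \<and> sliding_point V f (s, V))) \<and>
     (\<exists>p\<in>C. snd p \<noteq> V)"

definition finite_time_stable :: "real \<Rightarrow> (real \<times> real \<Rightarrow> real \<times> real) \<Rightarrow> (real \<times> real) set \<Rightarrow> bool" where
  "finite_time_stable V f C \<longleftrightarrow>
     (\<exists>d>0. \<forall>x. filippov_solution_on V f {0..} x \<and> (\<exists>p\<in>C. dist (x 0) p < d)
        \<longrightarrow> (\<exists>T\<ge>0. \<forall>t\<ge>T. x t \<in> C))"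

definition stribeck_oscillator ::
    "real \<Rightarrow> real \<Rightarrow> real \<Rightarrow> real \<Rightarrow> real \<Rightarrow> real \<Rightarrow> real \<times> real \<Rightarrow> real \<times> real" where
  "stribeck_oscillator \<alpha> \<beta> \<gamma> V c \<epsilon> = (\<lambda>(x1, x2).
     (x2,
      - x1 - \<epsilon> * c * x2
        - sgn (x2 - V) * ((1 - \<alpha>) / (1 + \<epsilon> * \<gamma> * \<bar>x2 - V\<bar>) + \<alpha> + \<epsilon> * \<beta> * (x2 - V)\<^sup>2)))"

end

theory Submission
  imports Defs
begin

text \<open>
  For small \<open>\<epsilon>\<close> and below the line \<open>x\<^sub>2 = V\<close> the system is a weakly perturbed rotation around
  \<open>(1, 0)\<close>, and the end point \<open>(1 - \<epsilon> c V, V)\<close> of the sliding segment lies almost on the circle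
  that touches the line. The orbit released there rotates once. The work done by the perturbation
  during the turn is, to first order in \<open>\<epsilon>\<close>, a positive multiple of
  \<open>- c + \<gamma> (1 - \<alpha>) - 2 \<beta> V\<close>, so the orbit gains energy and meets the line again, before the turn
  is complete and to the left of where it started, inside the sliding segment. Sliding along the belt
  carries it back to its start, which closes the cycle. The gain is measured by a corrected energy
  whose derivative is positive at every instant (\<open>W_growth\<close>, \<open>overshoot\<close>, \<open>stick_slip_arc\<close>); the
  arc exists by the Picard-Lindelof theorem (\<open>picard_lindelof_lipschitz\<close>).

  Stability comes from sliding alone. Friction opposes the relative motion, so the acceleration
  jumps downward when \<open>x\<^sub>2\<close> increases through \<open>V\<close>; hence the set-valued right-hand side
  is one-sided Lipschitz and two Filippov solutions separate at most exponentially
  (\<open>filippov_solutions_dist_le\<close>); in particular solutions are unique forward in time. A solution that starts close to a cycle with a sliding piece is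
  therefore still close to it when the cycle slides, is driven onto the line there within a short
  time, at a point of the cycle, and coincides with the cycle from then on
  (\<open>nearby_solutions_join_sliding_orbit\<close>). This gives finite-time stability, and isolation of the
  cycle follows because a closed orbit that joins the cycle must be the cycle
  (\<open>sliding_orbit_stable_limit_cycle\<close>).

  Filippov solutions are differentiable only almost everywhere, so the differential inequalities
  rest on the fact that an absolutely continuous function with nonpositive derivative almost
  everywhere does not increase (\<open>ac_deriv_nonpos_imp_le\<close>).
\<close>

section \<open>Absolutely continuous functions and differential inequalities\<close>

lemma division_endpoints:
  fixes P :: "real set set"
  assumes "P division_of T" "k \<in> P"
  shows "k = {Inf k..Sup k}" "Inf k \<le> Sup k" "Inf k \<in> k" "Sup k \<in> k" "k \<subseteq> T"
proof -
  obtain u v where "k = cbox u v" "k \<noteq> {}" "k \<subseteq> T"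
    using division_ofD(2,3,4)[OF assms(1)] assms(2) by blast
  then show "k = {Inf k..Sup k}" "Inf k \<le> Sup k" "Inf k \<in> k" "Sup k \<in> k" "k \<subseteq> T" by auto
qed

lemma acE:
  assumes "absolutely_continuous_fun_on S f" "e > 0"
  obtains d where "d > 0" "\<forall>P. P division_of \<Union>P \<longrightarrow> \<Union>P \<subseteq> S \<longrightarrow> (\<Sum>k\<in>P. Sup k - Inf k) < d
      \<longrightarrow> (\<Sum>k\<in>P. norm (f (Sup k) - f (Inf k))) < e"
  using assms(1)[unfolded absolutely_continuous_fun_on_def, rule_format, OF assms(2)]
  by (elim exE conjE) (simp add: that)

text \<open>All closure properties below come down to this: the increments of \<open>h\<close> are controlled by those of
  two absolutely continuous functions.\<close>

lemma ac_dominated: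
  assumes f: "absolutely_continuous_fun_on S f" and g: "absolutely_continuous_fun_on S g"
    and K: "\<And>s t. s \<in> S \<Longrightarrow> t \<in> S \<Longrightarrow> norm (h t - h s) \<le> K * (norm (f t - f s) + norm (g t - g s))"
  shows "absolutely_continuous_fun_on S h"
  unfolding absolutely_continuous_fun_on_def
proof (intro allI impI)
  fix e :: real assume "e > 0"
  define e' where "e' = e / (2 * \<bar>K\<bar> + 1)"
  have "(2 * \<bar>K\<bar> + 1) * e' = e"
    by (simp add: e'_def)
  moreover have "e' > 0"
    using \<open>e > 0\<close> by (auto simp: e'_def intro!: divide_pos_pos)
  ultimately have e': "e' > 0" "2 * \<bar>K\<bar> * e' < e" by (simp_all add: distrib_right)
  obtain d1 where d1: "d1 > 0" "\<forall>P. P division_of \<Union>P \<longrightarrow> \<Union>P \<subseteq> S \<longrightarrow> (\<Sum>k\<in>P. Sup k - Inf k) < d1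
      \<longrightarrow> (\<Sum>k\<in>P. norm (f (Sup k) - f (Inf k))) < e'"
    by (rule acE[OF f e'(1)])
  obtain d2 where d2: "d2 > 0" "\<forall>P. P division_of \<Union>P \<longrightarrow> \<Union>P \<subseteq> S \<longrightarrow> (\<Sum>k\<in>P. Sup k - Inf k) < d2
      \<longrightarrow> (\<Sum>k\<in>P. norm (g (Sup k) - g (Inf k))) < e'"
    by (rule acE[OF g e'(1)])
  have "(\<Sum>k\<in>P. norm (h (Sup k) - h (Inf k))) < e"
    if P: "P division_of \<Union>P" "\<Union>P \<subseteq> S" "(\<Sum>k\<in>P. Sup k - Inf k) < min d1 d2" for P
  proof -
    let ?F = "\<Sum>k\<in>P. norm (f (Sup k) - f (Inf k))" and ?G = "\<Sum>k\<in>P. norm (g (Sup k) - g (Inf k))"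
    have "(\<Sum>k\<in>P. norm (h (Sup k) - h (Inf k)))
        \<le> (\<Sum>k\<in>P. K * (norm (f (Sup k) - f (Inf k)) + norm (g (Sup k) - g (Inf k))))"
    proof (rule sum_mono)
      fix k assume "k \<in> P"
      then have "Inf k \<in> S" "Sup k \<in> S"
        using division_endpoints(3,4,5)[OF P(1), of k] P(2) by auto
      then show "norm (h (Sup k) - h (Inf k))
          \<le> K * (norm (f (Sup k) - f (Inf k)) + norm (g (Sup k) - g (Inf k)))"
        by (rule K)
    qed
    also have "\<dots> = K * (?F + ?G)"
      by (simp only: sum_distrib_left[symmetric] sum.distrib)
    also have "\<dots> \<le> \<bar>K\<bar> * (?F + ?G)"
      by (intro mult_right_mono add_nonneg_nonneg sum_nonneg) auto
    also have "\<dots> \<le> \<bar>K\<bar> * (e' + e')"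
      using d1(2)[rule_format, OF P(1,2)] d2(2)[rule_format, OF P(1,2)] P(3)
      by (intro mult_left_mono) auto
    finally show ?thesis using e'(2) by simp
  qed
  then show "\<exists>d>0. \<forall>P. P division_of \<Union>P \<and> \<Union>P \<subseteq> S \<and> (\<Sum>k\<in>P. Sup k - Inf k) < d
        \<longrightarrow> (\<Sum>k\<in>P. norm (h (Sup k) - h (Inf k))) < e"
    using d1(1) d2(1) by (intro exI[of _ "min d1 d2"]) auto
qed

lemma ac_ident: "absolutely_continuous_fun_on S (\<lambda>t::real. t)"
  unfolding absolutely_continuous_fun_on_def
proof (intro allI impI)
  fix e :: real assume e: "e > 0"
  have "(\<Sum>k\<in>P. norm (Sup k - Inf k)) = (\<Sum>k\<in>P. Sup k - Inf k)"
    if "P division_of \<Union>P" for P :: "real set set"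
    by (rule sum.cong) (use division_endpoints(2)[OF that] in auto)
  then show "\<exists>d>0. \<forall>P. P division_of \<Union>P \<and> \<Union>P \<subseteq> S \<and> (\<Sum>k\<in>P. Sup k - Inf k) < d
        \<longrightarrow> (\<Sum>k\<in>P. norm (Sup k - Inf k)) < e"
    using e by (intro exI[of _ e]) auto
qed

lemma ac_lipschitz:
  fixes f :: "real \<Rightarrow> 'a::real_normed_vector"
  assumes "L-lipschitz_on S f"
  shows "absolutely_continuous_fun_on S f"
proof (rule ac_dominated[OF ac_ident ac_ident, where K = L])
  fix s t assume "s \<in> S" "t \<in> S"
  then have "norm (f t - f s) \<le> L * norm (t - s)" using lipschitz_on_normD[OF assms] by blast
  moreover have "0 \<le> L * norm (t - s)"
    using lipschitz_on_nonneg[OF assms] by simp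
  ultimately show "norm (f t - f s) \<le> L * (norm (t - s) + norm (t - s))"
    unfolding distrib_left by linarith
qed

lemma ac_imp_continuous_on:
  fixes f :: "real \<Rightarrow> 'a::real_normed_vector"
  assumes "absolutely_continuous_fun_on {a..b} f"
  shows "continuous_on {a..b} f"
  unfolding continuous_on_iff
proof (intro ballI allI impI)
  fix t e :: real assume t: "t \<in> {a..b}" and e: "e > 0"
  obtain d where d: "d > 0" "\<forall>P. P division_of \<Union>P \<longrightarrow> \<Union>P \<subseteq> {a..b} \<longrightarrow> (\<Sum>k\<in>P. Sup k - Inf k) < d
      \<longrightarrow> (\<Sum>k\<in>P. norm (f (Sup k) - f (Inf k))) < e"
    by (rule acE[OF assms e])
  have "dist (f s) (f t) < e" if s: "s \<in> {a..b}" "dist s t < d" for s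
  proof -
    have "{{min s t..max s t}} division_of {min s t..max s t}"
      using division_of_self[of "min s t" "max s t"] by (simp add: cbox_interval)
    then have "(\<Sum>k\<in>{{min s t..max s t}}. norm (f (Sup k) - f (Inf k))) < e"
      using s t by (intro d(2)[rule_format]) (auto simp: dist_real_def)
    then show ?thesis by (cases "s \<le> t") (auto simp: dist_norm norm_minus_commute)
  qed
  then show "\<exists>d>0. \<forall>s\<in>{a..b}. dist s t < d \<longrightarrow> dist (f s) (f t) < e" using d(1) by blast
qed

lemma ac_bounded_linear:
  assumes "bounded_linear F" "absolutely_continuous_fun_on S f"
  shows "absolutely_continuous_fun_on S (\<lambda>t. F (f t))"
proof -
  interpret bounded_linear F by fact
  obtain K where K: "\<And>x. norm (F x) \<le> norm x * K" "K > 0" using pos_bounded by blast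
  show ?thesis
  proof (rule ac_dominated[OF assms(2) assms(2), where K = K])
    fix s t
    have "norm (F (f t) - F (f s)) \<le> norm (f t - f s) * K" using K(1) by (metis diff)
    moreover have "0 \<le> norm (f t - f s) * K" using K(2) by simp
    ultimately show "norm (F (f t) - F (f s)) \<le> K * (norm (f t - f s) + norm (f t - f s))"
      unfolding distrib_left by (simp add: mult.commute)
  qed
qed

lemma ac_diff:
  assumes "absolutely_continuous_fun_on S f" "absolutely_continuous_fun_on S g"
  shows "absolutely_continuous_fun_on S (\<lambda>t. f t - g t)"
proof (rule ac_dominated[OF assms, where K = 1])
  fix s t
  have "f t - g t - (f s - g s) = (f t - f s) - (g t - g s)" by simp
  then show "norm (f t - g t - (f s - g s)) \<le> 1 * (norm (f t - f s) + norm (g t - g s))"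
    by (metis norm_triangle_ineq4 mult_1)
qed

lemma ac_bounded_bilinear:
  assumes B: "bounded_bilinear B" and f: "absolutely_continuous_fun_on {a..b} f"
    and g: "absolutely_continuous_fun_on {a..b} g"
  shows "absolutely_continuous_fun_on {a..b} (\<lambda>t. B (f t) (g t))"
proof -
  interpret bounded_bilinear B by fact
  obtain K where K: "\<And>x y. norm (B x y) \<le> norm x * norm y * K" "K > 0" using pos_bounded by blast
  have "bounded (f ` {a..b})" "bounded (g ` {a..b})"
    using f g by (auto intro!: compact_imp_bounded compact_continuous_image ac_imp_continuous_on)
  then obtain M N where MN: "\<And>t. t \<in> {a..b} \<Longrightarrow> norm (f t) \<le> M" "\<And>t. t \<in> {a..b} \<Longrightarrow> norm (g t) \<le> N"
    unfolding bounded_iff by (metis imageI)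
  show ?thesis
  proof (rule ac_dominated[OF f g, where K = "K * max M N"])
    fix s t assume st: "s \<in> {a..b}" "t \<in> {a..b}"
    have "B (f t) (g t) - B (f s) (g s) = B (f t - f s) (g t) + B (f s) (g t - g s)"
      by (simp add: diff_left diff_right)
    then have "norm (B (f t) (g t) - B (f s) (g s))
        \<le> norm (f t - f s) * norm (g t) * K + norm (f s) * norm (g t - g s) * K"
      by (metis K(1) norm_triangle_le add_mono)
    also have "\<dots> \<le> norm (f t - f s) * max M N * K + max M N * norm (g t - g s) * K"
      using MN(1)[OF st(1)] MN(2)[OF st(2)] K(2)
      by (intro add_mono mult_right_mono mult_left_mono) auto
    also have "\<dots> = K * max M N * (norm (f t - f s) + norm (g t - g s))" by algebra
    finally show "norm (B (f t) (g t) - B (f s) (g s)) \<le> \<dots>" .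
  qed
qed

text \<open>Cousin's lemma replaces Lebesgue's differentiation theory: a tagged division can be chosen so
  fine that its intervals tagged in the exceptional null set have small total length, hence by
  absolute continuity carry little of the variation of \<open>f\<close>, while over every other interval the
  derivative at the tag keeps \<open>f\<close> from growing by more than \<open>e\<close> times the length.\<close>

lemma ac_deriv_nonpos_imp_le:
  fixes f :: "real \<Rightarrow> real"
  assumes "a \<le> b" and ac: "absolutely_continuous_fun_on {a..b} f" and N: "negligible N"
    and deriv: "\<And>t. t \<in> {a..b} - N \<Longrightarrow> \<exists>D\<le>0. (f has_real_derivative D) (at t within {a..b})"
  shows "f b \<le> f a"
proof (rule field_le_epsilon)
  fix e0 :: real assume "e0 > 0"
  define e where "e = e0 / (b - a + 1)"
  have "e * (b - a + 1) = e0" using \<open>a \<le> b\<close> by (simp add: e_def)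
  then have e: "e > 0" "e * (b - a) + e = e0"
    using \<open>e0 > 0\<close> \<open>a \<le> b\<close> by (simp_all add: e_def distrib_left)
  obtain d where d: "d > 0" "\<forall>P. P division_of \<Union>P \<longrightarrow> \<Union>P \<subseteq> {a..b} \<longrightarrow> (\<Sum>k\<in>P. Sup k - Inf k) < d
      \<longrightarrow> (\<Sum>k\<in>P. norm (f (Sup k) - f (Inf k))) < e"
    by (rule acE[OF ac e(1)])
  have "N \<in> sets lebesgue" using N by (simp add: negligible_imp_sets)
  then obtain U where U: "open U" "N \<subseteq> U" "U - N \<in> lmeasurable" "emeasure lebesgue (U - N) < ennreal d"
    using sets_lebesgue_outer_open d(1) by blast
  have Um: "U \<in> lmeasurable" "measure lebesgue U < d"
  proof -
    have "U = (U - N) \<union> N" using U(2) by blast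
    then show "U \<in> lmeasurable"
      using U(3) N negligible_imp_measurable by (metis fmeasurable.Un)
    have "measure lebesgue U = measure lebesgue (U - N)"
      using N \<open>U \<in> lmeasurable\<close> by (simp add: measure_Diff_null_set negligible_iff_null_sets)
    also have "\<dots> < d"
      using U(3,4) d(1) by (simp add: emeasure_eq_measure2 ennreal_less_iff)
    finally show "measure lebesgue U < d" .
  qed
  \<comment> \<open>Around a point of \<open>N\<close> the gauge stays inside \<open>U\<close>; elsewhere it
    is so small that the derivative governs the increment over any interval that contains the tag.\<close>
  have "\<exists>r>0. (t \<in> N \<longrightarrow> ball t r \<subseteq> U) \<and> (t \<in> {a..b} - N \<longrightarrow>
      (\<forall>y z. y \<in> {a..b} \<and> z \<in> {a..b} \<and> y \<in> ball t r \<and> z \<in> ball t r \<and> y \<le> t \<and> t \<le> z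
         \<longrightarrow> f z - f y \<le> e * (z - y)))" for t
  proof (cases "t \<in> {a..b} - N")
    case False
    then show ?thesis
    proof (cases "t \<in> N")
      case True
      then obtain r where "r > 0" "ball t r \<subseteq> U" using U(1,2) by (meson open_contains_ball subsetD)
      then show ?thesis using True by blast
    next
      case f: False
      with False show ?thesis using zero_less_one by blast
    qed
  next
    case True
    then obtain D where D: "D \<le> 0" "(f has_real_derivative D) (at t within {a..b})"
      using deriv by blast
    then have "(f has_derivative (\<lambda>h. D * h)) (at t within {a..b})"
      by (simp add: has_field_derivative_def)
    then obtain r where r: "r > 0" "\<And>y. y \<in> {a..b} \<Longrightarrow> norm (y - t) < r \<Longrightarrow>
        norm (f y - f t - D * (y - t)) \<le> e * norm (y - t)"
      using e(1) unfolding has_derivative_within_alt by blast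
    have "f z - f y \<le> e * (z - y)"
      if "y \<in> {a..b}" "z \<in> {a..b}" "y \<in> ball t r" "z \<in> ball t r" "y \<le> t" "t \<le> z" for y z
    proof -
      have "norm (f y - f t - D * (y - t)) \<le> e * norm (y - t)"
        "norm (f z - f t - D * (z - t)) \<le> e * norm (z - t)"
        by (rule r(2); use that in \<open>simp add: dist_real_def abs_minus_commute\<close>)+
      moreover have "D * (z - y) \<le> 0"
        using D(1) that by (simp add: mult_nonpos_nonneg)
      ultimately show ?thesis using that by (simp add: abs_le_iff algebra_simps)
    qed
    then show ?thesis using r(1) True by (intro exI[of _ r]) blast
  qed
  then obtain r where r: "\<And>t. r t > 0" "\<And>t. t \<in> N \<Longrightarrow> ball t (r t) \<subseteq> U"
    "\<And>t y z. t \<in> {a..b} - N \<Longrightarrow> y \<in> {a..b} \<Longrightarrow> z \<in> {a..b} \<Longrightarrow> y \<in> ball t (r t) \<Longrightarrow> z \<in> ball t (r t)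
      \<Longrightarrow> y \<le> t \<Longrightarrow> t \<le> z \<Longrightarrow> f z - f y \<le> e * (z - y)"
    by metis
  define G where "G = (\<lambda>t. ball t (r t))"
  have "gauge G" using r(1) by (auto simp: gauge_def G_def)
  then obtain p where p: "p tagged_division_of {a..b}" "G fine p" by (rule fine_division_exists_real)
  note pD = tagged_division_ofD[OF p(1)]
  define p1 where "p1 = {tk \<in> p. fst tk \<in> N}"
  define P where "P = snd ` p1"
  let ?inc = "\<lambda>k. f (Sup k) - f (Inf k)"
  have "p1 tagged_partial_division_of {a..b}"
    using p(1) by (auto simp: p1_def tagged_division_of_def intro: tagged_partial_division_subset)
  then have p1: "p1 tagged_division_of \<Union>P" and P: "P division_of \<Union>P"
    unfolding P_def by (auto intro: tagged_partial_division_of_Union_self partial_division_of_tagged_division)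
  have Psub: "\<Union>P \<subseteq> {a..b}" using pD(3) by (force simp: P_def p1_def)
  have "\<Union>P \<subseteq> U"
    using r(2) p(2) by (fastforce simp: P_def p1_def fine_def G_def)
  have "(\<Sum>k\<in>P. Sup k - Inf k) = (\<Sum>k\<in>P. measure lebesgue k)"
  proof (rule sum.cong[OF refl])
    fix k assume "k \<in> P"
    note k = division_endpoints(1,2)[OF P this]
    have "measure lebesgue {Inf k..Sup k} = Sup k - Inf k" using k(2) by simp
    then show "Sup k - Inf k = measure lebesgue k" using k(1) by simp
  qed
  also have "\<dots> = measure lebesgue (\<Union>P)" by (rule content_division[OF P])
  also have "\<dots> \<le> measure lebesgue U"
    using \<open>\<Union>P \<subseteq> U\<close> Um(1) P by (intro measure_mono_fmeasurable) (auto intro: fmeasurableD lmeasurable_division)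
  finally have "(\<Sum>k\<in>P. norm (?inc k)) < e" using Um(2) by (intro d(2)[rule_format] P Psub) simp
  moreover have "(\<Sum>k\<in>P. ?inc k) \<le> (\<Sum>k\<in>P. norm (?inc k))" by (rule sum_mono) simp
  moreover have "(\<Sum>(t,k)\<in>p1. ?inc k) = (\<Sum>k\<in>P. ?inc k)"
  proof -
    \<comment> \<open>The empty interval would contribute the increment from \<open>Inf {}\<close> to
      \<open>Sup {}\<close>; it never occurs, but the reindexing lemma asks about it.\<close>
    let ?inc' = "\<lambda>k. if k = {} then 0 else ?inc k"
    have "(\<Sum>(t,k)\<in>p1. ?inc k) = (\<Sum>(t,k)\<in>p1. ?inc' k)"
      by (intro sum.cong refl) (auto dest: tagged_division_ofD(2)[OF p1])
    also have "\<dots> = (\<Sum>k\<in>P. ?inc' k)"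
      unfolding P_def
    proof (rule sum.over_tagged_division_lemma[OF p1])
      fix u v :: real assume "box u v = {}"
      then show "?inc' (cbox u v) = 0" by (cases "u = v") (auto simp: box_eq_empty)
    qed
    also have "\<dots> = (\<Sum>k\<in>P. ?inc k)"
      using division_ofD(3)[OF P] by (intro sum.cong refl) auto
    finally show ?thesis .
  qed
  ultimately have bad: "(\<Sum>(t,k)\<in>p1. ?inc k) \<le> e" by linarith
  have le: "0 \<le> Sup k - Inf k" if "(t, k) \<in> p" for t k
    using division_endpoints(2)[OF division_of_tagged_division[OF p(1)], of k] that by force
  have "(\<Sum>(t,k)\<in>p - p1. ?inc k) \<le> (\<Sum>(t,k)\<in>p - p1. e * (Sup k - Inf k))"
  proof (rule sum_mono, clarify)
    fix t k assume tk: "(t, k) \<in> p" "(t, k) \<notin> p1"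
    note k = division_endpoints[OF division_of_tagged_division[OF p(1)], of k]
    have "k \<in> snd ` p" "k \<subseteq> G t" "t \<in> k" "t \<notin> N"
      using tk(1) pD(2)[OF tk(1)] fineD[OF p(2) tk(1)] tk(2) by (auto simp: p1_def image_iff intro: bexI[of _ "(t, k)"])
    moreover from k(1)[OF this(1)] \<open>t \<in> k\<close> have "Inf k \<le> t" "t \<le> Sup k"
      by (metis atLeastAtMost_iff)+
    ultimately show "?inc k \<le> e * (Sup k - Inf k)"
      using k(3,4,5) unfolding G_def by (intro r(3)[of t]) blast+
  qed
  also have "\<dots> \<le> (\<Sum>(t,k)\<in>p. e * (Sup k - Inf k))"
    using pD(1) e(1) le by (intro sum_mono2) auto
  also have "\<dots> = e * (\<Sum>(t,k)\<in>p. Sup k - Inf k)"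
    by (simp add: sum_distrib_left case_prod_unfold)
  also have "\<dots> = e * (b - a)"
    using additive_tagged_division_1[OF \<open>a \<le> b\<close> p(1), of "\<lambda>x. x"] by simp
  finally have good: "(\<Sum>(t,k)\<in>p - p1. ?inc k) \<le> e * (b - a)" .
  have "f b - f a = (\<Sum>(t,k)\<in>p. ?inc k)"
    using additive_tagged_division_1[OF \<open>a \<le> b\<close> p(1), of f] by simp
  also have "\<dots> = (\<Sum>(t,k)\<in>p - p1. ?inc k) + (\<Sum>(t,k)\<in>p1. ?inc k)"
    using pD(1) by (intro sum.subset_diff) (auto simp: p1_def)
  finally show "f b \<le> f a + e0" using good bad e(2) by linarith
qed

lemma lipschitz_on_of_derivative_bound:
  fixes f :: "real \<Rightarrow> 'a::real_normed_vector"
  assumes "\<And>t. t \<in> {a..b} \<Longrightarrow> (f has_vector_derivative f' t) (at t within {a..b})"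
    and "\<And>t. t \<in> {a..b} \<Longrightarrow> norm (f' t) \<le> B" "0 \<le> B"
  shows "B-lipschitz_on {a..b} f"
proof (rule lipschitz_onI)
  fix s t assume st: "s \<in> {a..b}" "t \<in> {a..b}"
  show "dist (f s) (f t) \<le> B * dist s t"
    unfolding dist_norm
  proof (rule differentiable_bound[where S = "{a..b}" and f' = "\<lambda>t h. h *\<^sub>R f' t"])
    fix r assume r: "r \<in> {a..b}"
    then show "(f has_derivative (\<lambda>h. h *\<^sub>R f' r)) (at r within {a..b})"
      using assms(1) by (simp add: has_vector_derivative_def)
    show "onorm (\<lambda>h. h *\<^sub>R f' r) \<le> B"
      using assms(2)[OF r] by (intro onorm_le) (simp add: mult.commute[of B] mult_left_mono)
  qed (use st in auto)
qed (use assms in auto)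

text \<open>Gronwall's inequality with the derivative bound required only almost everywhere.\<close>

lemma ac_gronwall:
  fixes D :: "real \<Rightarrow> real"
  assumes "a \<le> b" and ac: "absolutely_continuous_fun_on {a..b} D" and N: "negligible N"
    and deriv: "\<And>t. t \<in> {a..b} - N \<Longrightarrow> \<exists>D'\<le>k * D t. (D has_real_derivative D') (at t within {a..b})"
  shows "D b \<le> D a * exp (k * (b - a))"
proof -
  let ?E = "\<lambda>t. exp (- k * t)"
  have "continuous_on {a..b} (\<lambda>t. exp (- k * t) * - k)" by (intro continuous_intros)
  then have "bounded ((\<lambda>t. exp (- k * t) * - k) ` {a..b})"
    by (intro compact_imp_bounded compact_continuous_image) auto
  then obtain B where B: "\<And>t. t \<in> {a..b} \<Longrightarrow> norm (exp (- k * t) * - k) \<le> B" "B > 0"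
    unfolding bounded_pos by (metis imageI)
  have "B-lipschitz_on {a..b} ?E"
    by (rule lipschitz_on_of_derivative_bound[where f' = "\<lambda>t. exp (- k * t) * - k"])
      (use B in \<open>auto intro!: derivative_eq_intros simp: has_real_derivative_iff_has_vector_derivative[symmetric]\<close>)
  then have "absolutely_continuous_fun_on {a..b} (\<lambda>t. D t * ?E t)"
    by (intro ac_bounded_bilinear[OF bounded_bilinear_mult ac] ac_lipschitz)
  then have "D b * ?E b \<le> D a * ?E a"
  proof (rule ac_deriv_nonpos_imp_le[OF \<open>a \<le> b\<close> _ N])
    fix t assume "t \<in> {a..b} - N"
    then obtain D' where D': "D' \<le> k * D t" "(D has_real_derivative D') (at t within {a..b})"
      using deriv by blast
    have "((\<lambda>t. D t * ?E t) has_real_derivative (D' - k * D t) * ?E t) (at t within {a..b})"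
      by (rule derivative_eq_intros D' refl | simp add: algebra_simps)+
    moreover have "(D' - k * D t) * ?E t \<le> 0" using D'(1) by (intro mult_nonpos_nonneg) auto
    ultimately show "\<exists>D'\<le>0. ((\<lambda>t. D t * ?E t) has_real_derivative D') (at t within {a..b})" by blast
  qed
  then have "D b * ?E b * exp (k * b) \<le> D a * ?E a * exp (k * b)" by (intro mult_right_mono) auto
  then show ?thesis by (simp add: mult.assoc exp_add[symmetric] algebra_simps)
qed

section \<open>One-sided Lipschitz Filippov systems and orbits with a sliding piece\<close>

text \<open>The system is autonomous, so solutions may be shifted in time; the point is that a division of the
  shifted set is the shift of a division.\<close>

lemma ac_translation:
  fixes f :: "real \<Rightarrow> 'a::real_normed_vector"
  assumes "absolutely_continuous_fun_on ((\<lambda>t. t + s) ` S) f"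
  shows "absolutely_continuous_fun_on S (\<lambda>t. f (t + s))"
  unfolding absolutely_continuous_fun_on_def
proof (intro allI impI)
  fix e :: real assume e: "e > 0"
  obtain d where d: "d > 0" "\<forall>P. P division_of \<Union>P \<longrightarrow> \<Union>P \<subseteq> (\<lambda>t. t + s) ` S \<longrightarrow> (\<Sum>k\<in>P. Sup k - Inf k) < d
      \<longrightarrow> (\<Sum>k\<in>P. norm (f (Sup k) - f (Inf k))) < e"
    by (rule acE[OF assms e])
  have "(\<Sum>k\<in>P. norm (f (Sup k + s) - f (Inf k + s))) < e"
    if P: "P division_of \<Union>P" "\<Union>P \<subseteq> S" "(\<Sum>k\<in>P. Sup k - Inf k) < d" for P
  proof -
    let ?S = "\<lambda>k. (\<lambda>t. t + s) ` k"
    have inj: "inj_on ?S P" by (rule inj_on_image) (simp add: inj_on_def)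
    have ends: "Sup (?S k) = Sup k + s" "Inf (?S k) = Inf k + s" "?S k = {Inf k + s..Sup k + s}" if "k \<in> P" for k
    proof -
      note k = division_endpoints[OF P(1) that]
      have "?S k = ?S {Inf k..Sup k}" using k(1) by (rule arg_cong)
      then show "?S k = {Inf k + s..Sup k + s}" by (simp add: image_add_atLeastAtMost')
      then show "Sup (?S k) = Sup k + s" "Inf (?S k) = Inf k + s" using k(2) by simp_all
    qed
    have "(?S ` P) division_of \<Union>(?S ` P)"
    proof (rule division_ofI)
      show "finite (?S ` P)" using P(1) by blast
      fix K assume "K \<in> ?S ` P"
      then obtain k where k: "k \<in> P" "K = ?S k" by blast
      then show "K \<subseteq> \<Union>(?S ` P)" "K \<noteq> {}" using division_ofD(3)[OF P(1)] by auto
      show "\<exists>a b. K = cbox a b" using ends(3)[OF k(1)] k(2) by (metis cbox_interval)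
      fix K' assume "K' \<in> ?S ` P" "K \<noteq> K'"
      then obtain k' where k': "k' \<in> P" "K' = ?S k'" "k \<noteq> k'" using k by blast
      have "?S A = (+) s ` A" for A by (auto simp: add.commute)
      then have "interior (?S A) = ?S (interior A)" for A using interior_translation[of s A] by simp
      moreover have "interior k \<inter> interior k' = {}" using division_ofD(5)[OF P(1) k(1) k'(1,3)] .
      ultimately show "interior K \<inter> interior K' = {}" using k k' by auto
    qed simp
    moreover have "\<Union>(?S ` P) \<subseteq> ?S S" using P(2) by blast
    moreover have "(\<Sum>k\<in>?S ` P. Sup k - Inf k) = (\<Sum>k\<in>P. Sup k - Inf k)"
      unfolding sum.reindex[OF inj] o_def 
    proof (rule sum.cong[OF refl])
      fix k assume "k \<in> P"
      show "Sup (?S k) - Inf (?S k) = Sup k - Inf k" unfolding ends(1,2)[OF \<open>k \<in> P\<close>] by simp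
    qed
    ultimately have "(\<Sum>k\<in>?S ` P. norm (f (Sup k) - f (Inf k))) < e"
      using d(2)[rule_format, of "?S ` P"] P(3) by simp
    also have "(\<Sum>k\<in>?S ` P. norm (f (Sup k) - f (Inf k))) = (\<Sum>k\<in>P. norm (f (Sup k + s) - f (Inf k + s)))"
      unfolding sum.reindex[OF inj] o_def 
    proof (rule sum.cong[OF refl])
      fix k assume "k \<in> P"
      show "norm (f (Sup (?S k)) - f (Inf (?S k))) = norm (f (Sup k + s) - f (Inf k + s))"
        unfolding ends(1,2)[OF \<open>k \<in> P\<close>] by (rule refl)
    qed
    finally show ?thesis .
  qed
  then show "\<exists>d>0. \<forall>P. P division_of \<Union>P \<and> \<Union>P \<subseteq> S \<and> (\<Sum>k\<in>P. Sup k - Inf k) < d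
        \<longrightarrow> (\<Sum>k\<in>P. norm (f (Sup k + s) - f (Inf k + s))) < e"
    using d(1) by blast
qed

lemma filippov_solution_onE:
  assumes "filippov_solution_on V f J x"
  obtains N where "negligible N"
    "\<forall>t\<in>J - N. \<exists>v\<in>filippov_map V f (x t). (x has_vector_derivative v) (at t within J)"
proof -
  from assms obtain N where "negligible N"
    "{t. \<not> (t \<in> J \<longrightarrow> (\<exists>v\<in>filippov_map V f (x t). (x has_vector_derivative v) (at t within J)))} \<subseteq> N"
    unfolding filippov_solution_on_def eventually_ae_filter_negligible by (elim conjE exE)
  then show thesis by (intro that[of N]) blast+
qed

lemma filippov_solution_onI:
  assumes "\<And>a b. {a..b} \<subseteq> J \<Longrightarrow> absolutely_continuous_fun_on {a..b} x" "negligible N"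
    "\<And>t. t \<in> J - N \<Longrightarrow> \<exists>v\<in>filippov_map V f (x t). (x has_vector_derivative v) (at t within J)"
  shows "filippov_solution_on V f J x"
  unfolding filippov_solution_on_def eventually_ae_filter_negligible
  using assms by (intro conjI allI impI exI[of _ N]) blast+

lemma filippov_solution_on_ac:
  "filippov_solution_on V f J x \<Longrightarrow> {a..b} \<subseteq> J \<Longrightarrow> absolutely_continuous_fun_on {a..b} x"
  unfolding filippov_solution_on_def by blast

lemma filippov_solution_on_subset:
  assumes "filippov_solution_on V f J x" "I \<subseteq> J"
  shows "filippov_solution_on V f I x"
proof -
  obtain N where N: "negligible N"
    "\<forall>t\<in>J - N. \<exists>v\<in>filippov_map V f (x t). (x has_vector_derivative v) (at t within J)"
    using assms(1) by (rule filippov_solution_onE)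
  show ?thesis
  proof (rule filippov_solution_onI[OF _ N(1)])
    show "absolutely_continuous_fun_on {a..b} x" if "{a..b} \<subseteq> I" for a b
      using filippov_solution_on_ac[OF assms(1)] assms(2) that by blast
    fix t assume "t \<in> I - N"
    then obtain v where "v \<in> filippov_map V f (x t)" "(x has_vector_derivative v) (at t within J)"
      using N(2) assms(2) by blast
    then show "\<exists>v\<in>filippov_map V f (x t). (x has_vector_derivative v) (at t within I)"
      using has_vector_derivative_within_subset[OF _ assms(2)] by blast
  qed
qed

lemma filippov_solution_on_shift:
  assumes x: "filippov_solution_on V f J x" and I: "(\<lambda>t. t + s) ` I \<subseteq> J"
  shows "filippov_solution_on V f I (\<lambda>t. x (t + s))"
proof -
  obtain N where N: "negligible N"
    "\<forall>t\<in>J - N. \<exists>v\<in>filippov_map V f (x t). (x has_vector_derivative v) (at t within J)"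
    using x by (rule filippov_solution_onE)
  show ?thesis
  proof (rule filippov_solution_onI[where N = "(+) (- s) ` N"])
    fix a b assume "{a..b} \<subseteq> I"
    then have "(\<lambda>t. t + s) ` {a..b} \<subseteq> J" using I by blast
    moreover have "(\<lambda>t. t + s) ` {a..b} = {a + s..b + s}" by (simp add: image_add_atLeastAtMost')
    ultimately show "absolutely_continuous_fun_on {a..b} (\<lambda>t. x (t + s))"
      using x by (intro ac_translation) (simp add: filippov_solution_on_ac)
  next
    show "negligible ((+) (- s) ` N)" using N(1) by (rule negligible_translation)
  next
    fix t assume t: "t \<in> I - (+) (- s) ` N"
    then have "t + s \<in> J - N" using I by (auto simp: image_iff algebra_simps)
    then obtain v where v: "v \<in> filippov_map V f (x (t + s))" "(x has_vector_derivative v) (at (t + s) within J)"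
      using N(2) by blast
    have "((\<lambda>t. t + s) has_vector_derivative 1) (at t within I)"
      by (auto intro!: derivative_eq_intros)
    moreover have "(x has_vector_derivative v) (at (t + s) within (\<lambda>t. t + s) ` I)"
      using v(2) I by (rule has_vector_derivative_within_subset)
    ultimately have "(x \<circ> (\<lambda>t. t + s) has_vector_derivative 1 *\<^sub>R v) (at t within I)"
      by (rule vector_diff_chain_within)
    then show "\<exists>v\<in>filippov_map V f (x (t + s)). ((\<lambda>t. x (t + s)) has_vector_derivative v) (at t within I)"
      using v(1) by (auto simp: o_def)
  qed
qed

text \<open>Only an upper bound on how fast two trajectories can separate is imposed, so the right-hand side may
  jump, provided that it jumps downward across the line, as the acceleration does under dry friction.\<close>

definition one_sided_lipschitz :: "real \<Rightarrow> ('a::real_inner \<Rightarrow> 'a set) \<Rightarrow> bool" where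
  "one_sided_lipschitz L K \<longleftrightarrow> L \<ge> 0 \<and>
     (\<forall>p q. \<forall>a\<in>K p. \<forall>b\<in>K q. (p - q) \<bullet> (a - b) \<le> L * ((p - q) \<bullet> (p - q)))"

text \<open>The squared distance satisfies \<open>D' \<le> 2 L D\<close> almost everywhere, whatever selections of the
  set-valued right-hand side the two solutions follow. In particular solutions are unique forward
  in time, although different ones may merge on a sliding segment.\<close>

lemma filippov_solutions_dist_le:
  assumes osl: "one_sided_lipschitz L (filippov_map V f)"
    and x: "filippov_solution_on V f J x" and y: "filippov_solution_on V f J y"
    and J: "{a..b} \<subseteq> J" and "a \<le> b"
  shows "dist (x b) (y b) \<le> dist (x a) (y a) * exp (L * (b - a))"
proof -
  obtain N1 where N1: "negligible N1"
    "\<forall>t\<in>{a..b} - N1. \<exists>v\<in>filippov_map V f (x t). (x has_vector_derivative v) (at t within {a..b})"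
    using filippov_solution_on_subset[OF x J] by (rule filippov_solution_onE)
  obtain N2 where N2: "negligible N2"
    "\<forall>t\<in>{a..b} - N2. \<exists>v\<in>filippov_map V f (y t). (y has_vector_derivative v) (at t within {a..b})"
    using filippov_solution_on_subset[OF y J] by (rule filippov_solution_onE)
  define D where "D = (\<lambda>t. (x t - y t) \<bullet> (x t - y t))"
  have sq: "D t = (dist (x t) (y t))\<^sup>2" for t
    by (simp add: D_def dist_norm power2_norm_eq_inner)
  have "absolutely_continuous_fun_on {a..b} (\<lambda>t. x t - y t)"
    using x y J by (intro ac_diff filippov_solution_on_ac)
  then have "absolutely_continuous_fun_on {a..b} D"
    unfolding D_def by (intro ac_bounded_bilinear[OF bounded_bilinear_inner])
  then have "D b \<le> D a * exp (2 * L * (b - a))"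
  proof (rule ac_gronwall[OF \<open>a \<le> b\<close> _ negligible_Un[OF N1(1) N2(1)]])
    fix t assume t: "t \<in> {a..b} - (N1 \<union> N2)"
    then obtain v w where v: "v \<in> filippov_map V f (x t)" "(x has_vector_derivative v) (at t within {a..b})"
      and w: "w \<in> filippov_map V f (y t)" "(y has_vector_derivative w) (at t within {a..b})"
      using N1(2) N2(2) by blast
    have d: "((\<lambda>t. x t - y t) has_vector_derivative v - w) (at t within {a..b})"
      using v(2) w(2) by (rule has_vector_derivative_diff)
    have "(D has_vector_derivative (x t - y t) \<bullet> (v - w) + (v - w) \<bullet> (x t - y t)) (at t within {a..b})"
      unfolding D_def
      by (rule bounded_bilinear.has_vector_derivative[OF bounded_bilinear_inner d d])
    moreover have "(x t - y t) \<bullet> (v - w) \<le> L * D t"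
      using osl v(1) w(1) unfolding one_sided_lipschitz_def D_def by blast
    ultimately show "\<exists>D'\<le>2 * L * D t. (D has_real_derivative D') (at t within {a..b})"
      by (intro exI[of _ "2 * ((x t - y t) \<bullet> (v - w))"])
         (auto simp: has_real_derivative_iff_has_vector_derivative inner_commute)
  qed
  also have "\<dots> = (dist (x a) (y a) * exp (L * (b - a)))\<^sup>2"
    by (simp add: sq power_mult_distrib exp_double[symmetric] algebra_simps)
  finally show ?thesis
    unfolding sq by (rule power2_le_imp_le) simp
qed

lemma filippov_forward_unique:
  assumes "one_sided_lipschitz L (filippov_map V f)"
    and "filippov_solution_on V f {0..} x" "filippov_solution_on V f {0..} y"
    and "x r = y s" "0 \<le> r" "0 \<le> s" "0 \<le> t"
  shows "x (t + r) = y (t + s)"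
proof -
  have "filippov_solution_on V f {0..} (\<lambda>t. x (t + r))" "filippov_solution_on V f {0..} (\<lambda>t. y (t + s))"
    using assms by (auto intro!: filippov_solution_on_shift)
  from filippov_solutions_dist_le[OF assms(1) this, of 0 t] show ?thesis
    using assms by (auto simp: Icc_subset_Ici_iff)
qed

lemma limit_vectors_in_filippov_map:
  "lower_limit V f s \<in> filippov_map V f (s, V)" "upper_limit V f s \<in> filippov_map V f (s, V)"
proof -
  show "lower_limit V f s \<in> filippov_map V f (s, V)"
    unfolding filippov_map_def by (auto intro!: bexI[of _ 1])
  show "upper_limit V f s \<in> filippov_map V f (s, V)"
    unfolding filippov_map_def by (auto intro!: bexI[of _ 0])
qed

text \<open>Off the line, the one-sided Lipschitz condition compares the velocity with the limit vector on
  the same side, so the distance to the line decreases at rate at least \<open>m / 2\<close>.\<close>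

lemma sliding_segment_attracts:
  assumes osl: "one_sided_lipschitz L (filippov_map V f)"
    and x: "filippov_solution_on V f J x" and J: "{a..b} \<subseteq> J" and "a \<le> b"
    and slide: "\<And>s. s \<in> {\<xi>0..\<xi>1} \<Longrightarrow> m \<le> snd (lower_limit V f s)"
      "\<And>s. s \<in> {\<xi>0..\<xi>1} \<Longrightarrow> snd (upper_limit V f s) \<le> - m"
    and near: "\<And>t. t \<in> {a..b} \<Longrightarrow> fst (x t) \<in> {\<xi>0..\<xi>1}" "\<And>t. t \<in> {a..b} \<Longrightarrow> \<bar>snd (x t) - V\<bar> \<le> \<eta>"
    and \<eta>: "L * \<eta> \<le> m / 2" "\<eta> < m / 2 * (b - a)"
  shows "\<exists>t\<in>{a..b}. snd (x t) = V"
proof (rule ccontr)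
  assume no: "\<not> ?thesis"
  obtain N where N: "negligible N"
    "\<forall>t\<in>{a..b} - N. \<exists>v\<in>filippov_map V f (x t). (x has_vector_derivative v) (at t within {a..b})"
    using filippov_solution_on_subset[OF x J] by (rule filippov_solution_onE)
  have ac: "absolutely_continuous_fun_on {a..b} (\<lambda>t. snd (x t))"
    using x J by (intro ac_bounded_linear[OF bounded_linear_snd] filippov_solution_on_ac)
  then have cont: "continuous_on {a..b} (\<lambda>t. snd (x t))" by (rule ac_imp_continuous_on)
  \<comment> \<open>A solution that avoids the line stays on one side of it, which \<open>\<sigma>\<close>
    records.\<close>
  define \<sigma> where "\<sigma> = sgn (snd (x a) - V)"
  have a: "a \<in> {a..b}" "b \<in> {a..b}" using \<open>a \<le> b\<close> by auto
  have "snd (x a) \<noteq> V" using no a by blast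
  then have \<sigma>: "\<sigma> = 1 \<or> \<sigma> = -1" by (auto simp: \<sigma>_def sgn_if)
  have pos: "\<sigma> * (snd (x t) - V) > 0" if t: "t \<in> {a..b}" for t
  proof (rule ccontr)
    assume "\<not> \<sigma> * (snd (x t) - V) > 0"
    moreover have "continuous_on {a..t} (\<lambda>t. snd (x t))"
      using cont by (rule continuous_on_subset) (use t in auto)
    ultimately have "\<exists>r\<ge>a. r \<le> t \<and> snd (x r) = V"
      using t IVT'[of "\<lambda>t. snd (x t)" a V t] IVT2'[of "\<lambda>t. snd (x t)" t V a]
      by (auto simp: \<sigma>_def sgn_if split: if_splits)
    then show False using no t by auto
  qed
  have "\<sigma> * (snd (x b) - V) + m / 2 * b \<le> \<sigma> * (snd (x a) - V) + m / 2 * a"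
  proof (rule ac_deriv_nonpos_imp_le[OF \<open>a \<le> b\<close> _ N(1), where f = "\<lambda>t. \<sigma> * (snd (x t) - V) + m / 2 * t"])
    have "norm (\<sigma> * (snd (x t) - V) + m / 2 * t - (\<sigma> * (snd (x s) - V) + m / 2 * s))
        \<le> (1 + \<bar>m / 2\<bar>) * (norm (snd (x t) - snd (x s)) + norm (t - s))" for s t
    proof -
      have "\<sigma> * (snd (x t) - V) + m / 2 * t - (\<sigma> * (snd (x s) - V) + m / 2 * s)
          = \<sigma> * (snd (x t) - snd (x s)) + m / 2 * (t - s)" by algebra
      also have "norm \<dots> \<le> norm (snd (x t) - snd (x s)) + \<bar>m / 2\<bar> * norm (t - s)"
        using \<sigma> abs_triangle_ineq[of "\<sigma> * (snd (x t) - snd (x s))" "m / 2 * (t - s)"]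
        by (auto simp: abs_mult)
      also have "\<dots> \<le> (1 + \<bar>m / 2\<bar>) * (norm (snd (x t) - snd (x s)) + norm (t - s))"
        by (simp add: algebra_simps)
      finally show ?thesis .
    qed
    then show "absolutely_continuous_fun_on {a..b} (\<lambda>t. \<sigma> * (snd (x t) - V) + m / 2 * t)"
      by (rule ac_dominated[OF ac ac_ident])
  next
    fix t assume t: "t \<in> {a..b} - N"
    then obtain v where v: "v \<in> filippov_map V f (x t)" "(x has_vector_derivative v) (at t within {a..b})"
      using N(2) by blast
    let ?s = "fst (x t)" and ?w = "snd (x t) - V"
    \<comment> \<open>Comparing with the point of the line that has the same first coordinate removes the
      first component from the one-sided Lipschitz estimate.\<close>
    define u where "u = (if \<sigma> = 1 then upper_limit V f ?s else lower_limit V f ?s)"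
    have u: "\<sigma> * snd u \<le> - m"
      using slide near(1)[of t] t \<sigma> by (auto simp: u_def)
    have "u \<in> filippov_map V f (?s, V)" using limit_vectors_in_filippov_map by (auto simp: u_def)
    with osl v(1) have "(x t - (?s, V)) \<bullet> (v - u) \<le> L * ((x t - (?s, V)) \<bullet> (x t - (?s, V)))"
      unfolding one_sided_lipschitz_def by blast
    moreover have "x t - (?s, V) = (0, ?w)" by (simp add: prod_eq_iff)
    ultimately have "?w * (snd v - snd u) \<le> L * (?w * ?w)"
      by (simp add: inner_prod_def)
    moreover have "\<sigma> * \<sigma> = 1" using \<sigma> by auto
    moreover have "(\<sigma> * ?w) * (\<sigma> * (snd v - snd u)) = (\<sigma> * \<sigma>) * (?w * (snd v - snd u))"
      "(\<sigma> * ?w) * (L * (\<sigma> * ?w)) = (\<sigma> * \<sigma>) * (L * (?w * ?w))" by algebra+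
    ultimately have "(\<sigma> * ?w) * (\<sigma> * (snd v - snd u)) \<le> (\<sigma> * ?w) * (L * (\<sigma> * ?w))"
      by (simp only: mult_1_left)
    then have "\<sigma> * (snd v - snd u) \<le> L * (\<sigma> * ?w)"
      using pos[of t] t by (simp add: mult_le_cancel_left_pos)
    also have "\<dots> \<le> L * \<eta>"
      using near(2)[of t] t osl \<sigma> by (intro mult_left_mono) (auto simp: one_sided_lipschitz_def)
    finally have "\<sigma> * snd v + m / 2 \<le> 0" using u \<eta>(1) by (simp add: right_diff_distrib)
    moreover have "((\<lambda>t. snd (x t)) has_real_derivative snd v) (at t within {a..b})"
      using bounded_linear.has_vector_derivative[OF bounded_linear_snd v(2)]
      by (simp add: has_real_derivative_iff_has_vector_derivative)
    then have "((\<lambda>t. \<sigma> * (snd (x t) - V) + m / 2 * t) has_real_derivative \<sigma> * snd v + m / 2) (at t within {a..b})"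
      by (auto intro!: derivative_eq_intros)
    ultimately show "\<exists>D\<le>0. ((\<lambda>t. \<sigma> * (snd (x t) - V) + m / 2 * t) has_real_derivative D) (at t within {a..b})"
      by blast
  qed
  moreover have "\<sigma> * (snd (x a) - V) \<le> \<eta>" using near(2)[OF a(1)] \<sigma> by auto
  ultimately show False using pos[OF a(2)] \<eta>(2) by (simp add: algebra_simps)
qed

lemma periodic_add_int:
  fixes T :: real
  assumes "\<And>t. x (t + T) = x t"
  shows "x (t + of_int k * T) = x t"
proof -
  have nat: "x (t + of_nat n * T) = x t" for n t
  proof (induction n)
    case (Suc n)
    have "x (t + of_nat (Suc n) * T) = x ((t + of_nat n * T) + T)" by (simp add: algebra_simps)
    then show ?case using assms Suc by metis
  qed simp
  show ?thesis
  proof (cases "k \<ge> 0")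
    case True
    then show ?thesis using nat[of t "nat k"] by simp
  next
    case False
    then show ?thesis using nat[of "t + of_int k * T" "nat (- k)"] by simp
  qed
qed

text \<open>Why stability is in finite time: a nearby solution shadows the cycle for one period, by
  continuous dependence, so it is carried close to the sliding segment and stays close while the
  cycle slides. There it is driven onto the line, at a point of the cycle; forward uniqueness does
  the rest.\<close>

lemma nearby_solutions_join_sliding_orbit:
  assumes osl: "one_sided_lipschitz L (filippov_map V f)"
    and X: "filippov_solution_on V f UNIV X" and "T > 0" and per: "\<And>t. X (t + T) = X t"
    and slide: "m > 0" "\<And>s. s \<in> {\<xi>0..\<xi>1} \<Longrightarrow> m \<le> snd (lower_limit V f s)"
      "\<And>s. s \<in> {\<xi>0..\<xi>1} \<Longrightarrow> snd (upper_limit V f s) \<le> - m"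
    and seg: "\<And>s. s \<in> {\<xi>0..\<xi>1} \<Longrightarrow> (s, V) \<in> range X"
    and window: "t0 < t1" "\<rho> > 0" "\<And>t. t \<in> {t0..t1} \<Longrightarrow> snd (X t) = V"
      "\<And>t. t \<in> {t0..t1} \<Longrightarrow> fst (X t) \<in> {\<xi>0 + \<rho>..\<xi>1 - \<rho>}"
  shows "\<exists>d>0. \<forall>x. filippov_solution_on V f {0..} x \<and> (\<exists>p\<in>range X. dist (x 0) p < d)
      \<longrightarrow> (\<exists>r\<ge>0. \<exists>s. \<forall>t\<ge>0. x (t + r) = X (t + s))"
proof -
  have L: "L \<ge> 0" using osl by (simp add: one_sided_lipschitz_def)
  define h where "h = t1 - t0"
  have h: "h > 0" using window by (simp add: h_def)
  define \<eta> where "\<eta> = min \<rho> (min (m / (2 * (L + 1))) (m * h / 4))"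
  have mh: "m * h > 0" using \<open>m > 0\<close> h by simp
  have \<eta>: "\<eta> > 0" "\<eta> \<le> \<rho>" "\<eta> \<le> m / (2 * (L + 1))" "\<eta> < m / 2 * h"
  proof -
    have "m / (2 * (L + 1)) > 0" using \<open>m > 0\<close> L by simp
    then show "\<eta> > 0" using window(2) mh by (simp add: \<eta>_def)
    show "\<eta> \<le> \<rho>" "\<eta> \<le> m / (2 * (L + 1))" by (simp_all add: \<eta>_def)
    have "\<eta> \<le> m * h / 4" unfolding \<eta>_def by (intro min.coboundedI2 order_refl)
    also have "\<dots> < m * h / 2" using mh by linarith
    finally show "\<eta> < m / 2 * h" by simp
  qed
  have "L * \<eta> \<le> (L + 1) * (m / (2 * (L + 1)))" using \<eta> L by (intro mult_mono) auto
  also have "\<dots> = m / 2" using L by (simp add: divide_simps)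
  finally have L\<eta>: "L * \<eta> \<le> m / 2" .
  \<comment> \<open>Within time \<open>T + h\<close> the cycle goes through its whole sliding window, and by
    then distances have grown by a factor of at most \<open>exp (L (T + h))\<close>.\<close>
  define d where "d = \<eta> * exp (- L * (T + h))"
  have "d > 0" using \<eta> by (simp add: d_def)
  have "\<exists>r\<ge>0. \<exists>s. \<forall>t\<ge>0. x (t + r) = X (t + s)"
    if x: "filippov_solution_on V f {0..} x" and q: "dist (x 0) (X r) < d" for x r
  proof -
    \<comment> \<open>\<open>a\<close> is a time within the first period at which the cycle, started at
      \<open>X r\<close>, enters the sliding window.\<close>
    define k where "k = \<lceil>(r - t0) / T\<rceil>"
    define a where "a = t0 + of_int k * T - r"
    have "(r - t0) / T \<le> of_int k" "of_int k < (r - t0) / T + 1" unfolding k_def by linarith+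
    then have a: "0 \<le> a" "a \<le> T" using \<open>T > 0\<close> by (simp_all add: a_def field_simps)
    define y where "y = (\<lambda>t. X (t + r))"
    have y: "filippov_solution_on V f {0..} y"
      unfolding y_def using X by (rule filippov_solution_on_shift) simp
    have close: "dist (x t) (y t) \<le> \<eta>" if t: "t \<in> {a..a + h}" for t
    proof -
      have "dist (x t) (y t) \<le> dist (x 0) (y 0) * exp (L * (t - 0))"
        using t a by (intro filippov_solutions_dist_le[OF osl x y]) auto
      also have "\<dots> \<le> d * exp (L * (T + h))"
        using q t a L h \<open>d > 0\<close> by (intro mult_mono) (auto simp: y_def mult_left_mono)
      also have "\<dots> = \<eta>" by (simp add: d_def mult_exp_exp)
      finally show ?thesis .
    qed
    have y_slides: "snd (y t) = V \<and> fst (y t) \<in> {\<xi>0 + \<rho>..\<xi>1 - \<rho>}" if t: "t \<in> {a..a + h}" for t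
    proof -
      have "t + r = (t - a + t0) + of_int k * T" by (simp add: a_def)
      then have "y t = X (t - a + t0)" unfolding y_def by (simp only: periodic_add_int[where x = X, OF per])
      then show ?thesis using window(3,4)[of "t - a + t0"] t by (simp add: h_def)
    qed
    have near: "fst (x t) \<in> {\<xi>0..\<xi>1}" "\<bar>snd (x t) - V\<bar> \<le> \<eta>" if t: "t \<in> {a..a + h}" for t
      using close[OF t] y_slides[OF t] \<eta>(2) dist_fst_le[of "x t" "y t"] dist_snd_le[of "x t" "y t"]
      by (auto simp: dist_real_def abs_le_iff)
    have "\<exists>t\<in>{a..a + h}. snd (x t) = V"
      using h a \<eta>(4) by (intro sliding_segment_attracts[OF osl x _ _ slide(2,3) near L\<eta>]) auto
    then obtain t where t: "t \<in> {a..a + h}" "snd (x t) = V" by blast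
    then have "x t = (fst (x t), V)" by (simp add: prod_eq_iff)
    then obtain s where s: "x t = X s" using seg[OF near(1)[OF t(1)]] by (metis imageE)
    have "filippov_solution_on V f {0..} (\<lambda>t. X (t + s))"
      using X by (rule filippov_solution_on_shift) simp
    from filippov_forward_unique[OF osl x this, of t 0] have "\<forall>u\<ge>0. x (u + t) = X (u + s)"
      using s t a by auto
    then show ?thesis using t a by (intro exI[of _ t]) auto
  qed
  then show ?thesis using \<open>d > 0\<close> by blast
qed

text \<open>Isolation follows from the same joining property: another closed orbit that comes near the cycle
  ends up running along it, hence by periodicity of both coincides with it.\<close>

lemma sliding_orbit_stable_limit_cycle:
  assumes osl: "one_sided_lipschitz L (filippov_map V f)"
    and X: "filippov_solution_on V f UNIV X" "T > 0" "\<And>t. X (t + T) = X t" "\<not> X constant_on UNIV"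
    and slide: "m > 0" "\<And>s. s \<in> {\<xi>0..\<xi>1} \<Longrightarrow> m \<le> snd (lower_limit V f s)"
      "\<And>s. s \<in> {\<xi>0..\<xi>1} \<Longrightarrow> snd (upper_limit V f s) \<le> - m"
    and seg: "\<And>s. s \<in> {\<xi>0..\<xi>1} \<Longrightarrow> (s, V) \<in> range X"
    and window: "t0 < t1" "\<rho> > 0" "\<And>t. t \<in> {t0..t1} \<Longrightarrow> snd (X t) = V"
      "\<And>t. t \<in> {t0..t1} \<Longrightarrow> fst (X t) \<in> {\<xi>0 + \<rho>..\<xi>1 - \<rho>}"
  shows "limit_cycle V f (range X)" "finite_time_stable V f (range X)"
proof -
  obtain d where d: "d > 0" "\<And>x. filippov_solution_on V f {0..} x \<Longrightarrow> \<exists>p\<in>range X. dist (x 0) p < d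
      \<Longrightarrow> \<exists>r\<ge>0. \<exists>s. \<forall>t\<ge>0. x (t + r) = X (t + s)"
    using nearby_solutions_join_sliding_orbit[OF osl X(1,2,3) slide seg window] by blast
  show "finite_time_stable V f (range X)"
    unfolding finite_time_stable_def
  proof (rule exI[of _ d], intro conjI allI impI)
    fix x assume "filippov_solution_on V f {0..} x \<and> (\<exists>p\<in>range X. dist (x 0) p < d)"
    then obtain r s where rs: "r \<ge> 0" "\<And>t. t \<ge> 0 \<Longrightarrow> x (t + r) = X (t + s)" using d(2) by blast
    have "x t \<in> range X" if "t \<ge> r" for t
      using rs(2)[of "t - r"] that by simp
    then show "\<exists>T\<ge>0. \<forall>t\<ge>T. x t \<in> range X" using rs(1) by blast
  qed (rule d(1))
  have "D = range X" if D: "closed_orbit V f D" "p \<in> D" "q \<in> range X" "dist p q < d" for D p q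
  proof -
    obtain y S where y: "filippov_solution_on V f UNIV y" "S > 0" "\<And>t. y (t + S) = y t" "D = range y"
      using D(1) unfolding closed_orbit_def by blast
    obtain u where u: "p = y u" using D(2) y(4) by blast
    have "filippov_solution_on V f {0..} (\<lambda>t. y (t + u))"
      using y(1) by (rule filippov_solution_on_shift) simp
    with d(2)[of "\<lambda>t. y (t + u)"] D(3,4) u
    obtain r s where rs: "\<And>t. t \<ge> 0 \<Longrightarrow> y (t + r + u) = X (t + s)" by auto
    have wrap: "\<exists>k::int. t + of_int k * S \<ge> 0" if "S > 0" for S t :: real
    proof
      have "- t / S \<le> of_int \<lceil>- t / S\<rceil>" by linarith
      then have "- t \<le> of_int \<lceil>- t / S\<rceil> * S" using that by (simp only: pos_divide_le_eq)
      then show "t + of_int \<lceil>- t / S\<rceil> * S \<ge> 0" by linarith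
    qed
    have "y t \<in> range X" for t
    proof -
      obtain k :: int where "t - r - u + of_int k * S \<ge> 0" using wrap[OF y(2)] by blast
      from rs[OF this] have "y (t + of_int k * S) \<in> range X" by (simp add: algebra_simps)
      then show ?thesis by (simp only: periodic_add_int[where x = y, OF y(3)])
    qed
    moreover have "X t \<in> range y" for t
    proof -
      obtain k :: int where "t - s + of_int k * T \<ge> 0" using wrap[OF X(2)] by blast
      from rs[OF this] have "X (t + of_int k * T) \<in> range y" by (metis rangeI add_diff_cancel_left' add.commute diff_add_cancel add.assoc)
      then show ?thesis by (simp only: periodic_add_int[where x = X, OF X(3)])
    qed
    ultimately show ?thesis unfolding y(4) by blast
  qed
  moreover have "closed_orbit V f (range X)"
    unfolding closed_orbit_def using X by blast
  ultimately show "limit_cycle V f (range X)"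
    unfolding limit_cycle_def using d(1) by blast
qed

section \<open>Existence of arcs and their periodic extension\<close>

text \<open>In the norm weighted by \<open>exp (- (L + 1) t)\<close> the Picard operator is a contraction on the whole
  interval at once, however long it is.\<close>

lemma picard_lindelof_lipschitz:
  fixes F :: "'a::banach \<Rightarrow> 'a"
  assumes F: "L-lipschitz_on UNIV F" and "0 \<le> T"
  shows "\<exists>z. z 0 = z0 \<and> (\<forall>t\<in>{0..T}. (z has_vector_derivative F (z t)) (at t within {0..T}))"
proof -
  have L: "0 \<le> L" using F by (rule lipschitz_on_nonneg)
  have contF: "continuous_on S F" for S
    using lipschitz_on_continuous_on[OF F] continuous_on_subset by blast
  define k where "k = L + 1"
  have k: "k > 0" using L by (simp add: k_def)
  define I where "I = (\<lambda>(w::real \<Rightarrow>\<^sub>C 'a) t. integral {0..t} (\<lambda>s. F (exp (k * s) *\<^sub>R w s)))"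
  have cont: "continuous_on S (\<lambda>s. F (exp (k * s) *\<^sub>R apply_bcontfun w s))" for w :: "real \<Rightarrow>\<^sub>C 'a" and S
    by (rule continuous_on_compose2[OF contF[of UNIV]]) (auto intro!: continuous_intros)
  have I_deriv: "(I w has_vector_derivative F (exp (k * t) *\<^sub>R w t)) (at t within {0..T})"
    if "t \<in> {0..T}" for w :: "real \<Rightarrow>\<^sub>C 'a" and t
    unfolding I_def by (rule integral_has_vector_derivative[OF cont that])
  define Q where "Q = (\<lambda>(w::real \<Rightarrow>\<^sub>C 'a) t. exp (- k * t) *\<^sub>R (z0 + I w t))"
  have "continuous_on {0..T} (I w)" for w
    using I_deriv by (intro continuous_on_vector_derivative) blast
  then have "continuous_on {0..T} (Q w)" for w
    unfolding Q_def by (intro continuous_intros)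
  then have Q_bcont: "ext_cont (Q w) 0 T \<in> bcontfun" for w
  proof -
    assume c: "\<And>w. continuous_on {0..T} (Q w)"
    have "continuous_on UNIV (ext_cont (Q w) 0 T)"
      using c[of w] by (intro continuous_on_ext_cont) simp
    moreover have "bounded (Q w ` {0..T})"
      using c[of w] by (intro compact_imp_bounded compact_continuous_image) auto
    then have "bounded (range (ext_cont (Q w) 0 T))"
      using clamp_bounded[of "Q w" 0 T] by (simp add: ext_cont_def)
    ultimately show ?thesis by (simp add: bcontfun_def)
  qed
  define G where "G = (\<lambda>w. Bcontfun (ext_cont (Q w) 0 T))"
  have G_apply: "apply_bcontfun (G w) t = Q w (clamp 0 T t)" for w t
    unfolding G_def Bcontfun_inverse[OF Q_bcont] by (simp add: ext_cont_def)
  have clamp: "clamp 0 T t \<in> {0..T}" for t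
    using clamp_in_interval[of 0 T t] \<open>0 \<le> T\<close> by simp
  have contraction: "dist (Q w t) (Q w' t) \<le> L / k * dist w w'" if t: "t \<in> {0..T}" for w w' t
  proof -
    let ?d = "dist w w'"
    have int: "(\<lambda>s. F (exp (k * s) *\<^sub>R w s)) integrable_on {0..t}" for w :: "real \<Rightarrow>\<^sub>C 'a"
      by (rule integrable_continuous_real[OF cont])
    have E: "((\<lambda>s. L * ?d * exp (k * s)) has_integral L * ?d * (exp (k * t) / k) - L * ?d * (exp (k * 0) / k)) {0..t}"
      using t k by (intro fundamental_theorem_of_calculus)
        (auto intro!: derivative_eq_intros simp: has_real_derivative_iff_has_vector_derivative[symmetric])
    have "norm (integral {0..t} (\<lambda>s. F (exp (k * s) *\<^sub>R w s) - F (exp (k * s) *\<^sub>R w' s)))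
        \<le> integral {0..t} (\<lambda>s. L * ?d * exp (k * s))"
    proof (rule integral_norm_bound_integral)
      show "(\<lambda>s. F (exp (k * s) *\<^sub>R w s) - F (exp (k * s) *\<^sub>R w' s)) integrable_on {0..t}"
        by (intro integrable_diff int)
      show "(\<lambda>s. L * ?d * exp (k * s)) integrable_on {0..t}" using E by blast
      fix s
      have "norm (F (exp (k * s) *\<^sub>R w s) - F (exp (k * s) *\<^sub>R w' s))
          \<le> L * norm (exp (k * s) *\<^sub>R w s - exp (k * s) *\<^sub>R w' s)"
        using lipschitz_on_normD[OF F] by simp
      also have "\<dots> = L * (exp (k * s) * dist (w s) (w' s))"
        by (simp add: dist_norm flip: scaleR_diff_right)
      also have "\<dots> \<le> L * (exp (k * s) * ?d)"
        using L by (intro mult_left_mono dist_bounded) auto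
      finally show "norm (F (exp (k * s) *\<^sub>R w s) - F (exp (k * s) *\<^sub>R w' s)) \<le> L * ?d * exp (k * s)"
        by (simp add: mult_ac)
    qed
    also have "\<dots> = L * ?d * (exp (k * t) / k) - L * ?d * (exp (k * 0) / k)"
      using E by (rule integral_unique)
    also have "\<dots> \<le> L * ?d * (exp (k * t) / k)" using L k by simp
    finally have "norm (I w t - I w' t) \<le> L * ?d * (exp (k * t) / k)"
      unfolding I_def using integral_diff[OF int[of w] int[of w']] by simp
    then have "exp (- k * t) * norm (I w t - I w' t) \<le> exp (- k * t) * (L * ?d * (exp (k * t) / k))"
      by (intro mult_left_mono) auto
    also have "\<dots> = L / k * ?d" by (simp add: exp_minus)
    also have "exp (- k * t) * norm (I w t - I w' t) = dist (Q w t) (Q w' t)"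
      by (simp add: Q_def dist_norm flip: scaleR_diff_right)
    finally show ?thesis .
  qed
  have "\<exists>!w. G w = w"
  proof (rule banach_fix_type)
    show "0 \<le> L / k" "L / k < 1" using L by (auto simp: k_def)
    show "\<forall>w w'. dist (G w) (G w') \<le> L / k * dist w w'"
      using contraction[OF clamp] by (auto intro!: dist_bound simp: G_apply)
  qed
  then obtain w where w: "G w = w" by blast
  define z where "z = (\<lambda>t. exp (k * t) *\<^sub>R apply_bcontfun w t)"
  have z: "z t = z0 + I w t" if t: "t \<in> {0..T}" for t
  proof -
    have "apply_bcontfun w t = Q w t" using G_apply[of w t] w t by simp
    then show ?thesis by (simp add: z_def Q_def exp_minus)
  qed
  have "(z has_vector_derivative F (z t)) (at t within {0..T})" if t: "t \<in> {0..T}" for t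
  proof -
    have "((\<lambda>t. z0 + I w t) has_vector_derivative F (z t)) (at t within {0..T})"
      using I_deriv[OF t, of w] by (auto intro!: derivative_eq_intros simp: z_def)
    then show ?thesis
      using has_vector_derivative_transform[OF t, of z "\<lambda>t. z0 + I w t"] z by auto
  qed
  moreover have "z 0 = z0" using z[of 0] \<open>0 \<le> T\<close> by (simp add: I_def)
  ultimately show ?thesis by blast
qed

text \<open>Closing up an arc with finitely many corners: the extension stays Lipschitz because the end values
  agree, and its corners form a countable set, on which a Filippov solution is not constrained.\<close>

lemma periodic_extension:
  fixes Z :: "real \<Rightarrow> real \<times> real"
  assumes "T > 0" and lip: "B-lipschitz_on {0..T} Z" and closed: "Z T = Z 0" and "finite S"
    and deriv: "\<And>t. t \<in> {0<..<T} - S \<Longrightarrow> \<exists>v\<in>filippov_map V f (Z t). (Z has_vector_derivative v) (at t)"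
  shows "\<exists>X. filippov_solution_on V f UNIV X \<and> (\<forall>t. X (t + T) = X t) \<and> (\<forall>t\<in>{0..T}. X t = Z t)"
proof -
  define X where "X = (\<lambda>t. Z (t - of_int \<lfloor>t / T\<rfloor> * T))"
  have floor: "of_int \<lfloor>t / T\<rfloor> * T \<le> t" "t < (of_int \<lfloor>t / T\<rfloor> + 1) * T" for t
  proof -
    have "of_int \<lfloor>t / T\<rfloor> \<le> t / T" "t / T < of_int \<lfloor>t / T\<rfloor> + 1" by linarith+
    then show "of_int \<lfloor>t / T\<rfloor> * T \<le> t" "t < (of_int \<lfloor>t / T\<rfloor> + 1) * T"
      using \<open>T > 0\<close> by (simp_all only: pos_le_divide_eq pos_divide_less_eq)
  qed
  have X_on: "X t = Z (t - of_int n * T)" if "of_int n * T \<le> t" "t < (of_int n + 1) * T" for t n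
  proof -
    have "of_int n \<le> t / T" "t / T < of_int n + 1"
      using that \<open>T > 0\<close> by (simp_all only: pos_le_divide_eq pos_divide_less_eq)
    then have "\<lfloor>t / T\<rfloor> = n" by (rule floor_unique)
    then show ?thesis by (simp add: X_def)
  qed
  have "dist (X s) (X t) \<le> B * (t - s)" if "s \<le> t" for s t
  proof (cases "\<lfloor>s / T\<rfloor> = \<lfloor>t / T\<rfloor>")
    case True
    then show ?thesis
      using lipschitz_onD[OF lip, of "s - of_int \<lfloor>t / T\<rfloor> * T" "t - of_int \<lfloor>t / T\<rfloor> * T"]
        floor[of s] floor[of t] that
      by (simp add: X_def dist_real_def algebra_simps)
  next
    case False
    let ?m = "\<lfloor>s / T\<rfloor>" and ?n = "\<lfloor>t / T\<rfloor>"
    have "s / T \<le> t / T" using that \<open>T > 0\<close> by (simp add: divide_right_mono)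
    then have "?m + 1 \<le> ?n" using False floor_mono[of "s / T" "t / T"] by linarith
    then have "of_int (?m + 1) * T \<le> of_int ?n * T"
      using \<open>T > 0\<close> by (intro mult_right_mono) auto
    then have mn: "of_int ?m * T + T \<le> of_int ?n * T" by (simp add: algebra_simps)
    have "dist (X s) (Z T) \<le> B * dist (s - of_int ?m * T) T"
      unfolding X_def using floor[of s] \<open>T > 0\<close>
      by (intro lipschitz_onD[OF lip]) (auto simp: algebra_simps)
    moreover have "dist (Z 0) (X t) \<le> B * dist 0 (t - of_int ?n * T)"
      unfolding X_def using floor[of t] \<open>T > 0\<close>
      by (intro lipschitz_onD[OF lip]) (auto simp: algebra_simps)
    ultimately have "dist (X s) (X t) \<le> B * dist (s - of_int ?m * T) T + B * dist 0 (t - of_int ?n * T)"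
      using dist_triangle[of "X s" "X t" "Z T"] closed by simp
    also have "\<dots> = B * ((T - (s - of_int ?m * T)) + (t - of_int ?n * T))"
      using floor[of s] floor[of t] by (simp add: dist_real_def algebra_simps)
    also have "\<dots> \<le> B * (t - s)"
      using mn lipschitz_on_nonneg[OF lip] by (intro mult_left_mono) auto
    finally show ?thesis .
  qed
  note le = this
  have lipX: "B-lipschitz_on UNIV X"
  proof (rule lipschitz_onI[OF _ lipschitz_on_nonneg[OF lip]])
    fix s t :: real
    show "dist (X s) (X t) \<le> B * dist s t"
      using le[of s t] le[of t s] by (cases "s \<le> t") (auto simp: dist_real_def dist_commute)
  qed
  define N where "N = (\<Union>n::int. (\<lambda>u. of_int n * T + u) ` insert 0 S)"
  have "countable N" unfolding N_def using \<open>finite S\<close> by (auto intro: countable_finite)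
  then have "negligible N"
    unfolding negligible_iff_null_sets by (intro null_sets_completionI countable_imp_null_set_lborel)
  moreover have "\<exists>v\<in>filippov_map V f (X t). (X has_vector_derivative v) (at t)" if "t \<notin> N" for t
  proof -
    define n where "n = \<lfloor>t / T\<rfloor>"
    define u where "u = t - of_int n * T"
    have t: "t = of_int n * T + u" by (simp add: u_def)
    then have "u \<notin> insert 0 S" using that unfolding N_def by blast
    moreover have "0 \<le> u" "u < T" using floor[of t] by (simp_all add: u_def n_def algebra_simps)
    ultimately have u: "u \<in> {0<..<T} - S" by auto
    then obtain v where v: "v \<in> filippov_map V f (Z u)" "(Z has_vector_derivative v) (at u)"
      using deriv by blast
    have "((\<lambda>t. t - of_int n * T) has_vector_derivative 1) (at t)"
      by (auto intro!: derivative_eq_intros)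
    from vector_diff_chain_at[OF this, of Z v] v(2)
    have "((\<lambda>t. Z (t - of_int n * T)) has_vector_derivative v) (at t)"
      by (simp add: u_def o_def)
    then have "(X has_vector_derivative v) (at t)"
    proof (rule has_vector_derivative_transform_within_open)
      show "open {of_int n * T<..<(of_int n + 1) * T}" by simp
      show "t \<in> {of_int n * T<..<(of_int n + 1) * T}" using u by (simp add: t algebra_simps)
      show "Z (y - of_int n * T) = X y" if "y \<in> {of_int n * T<..<(of_int n + 1) * T}" for y
        using X_on[of n y] that by simp
    qed
    moreover have "X t = Z u" by (simp add: X_def u_def n_def)
    ultimately show ?thesis using v(1) by auto
  qed
  ultimately have "filippov_solution_on V f UNIV X"
    by (intro filippov_solution_onI[where N = N] ac_lipschitz[OF lipschitz_on_subset[OF lipX]]) auto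
  moreover have "X (t + T) = X t" for t
    using \<open>T > 0\<close> by (simp add: X_def add_divide_distrib algebra_simps)
  moreover have "X t = Z t" if t: "t \<in> {0..T}" for t
  proof (cases "t = T")
    case True
    then show ?thesis using X_on[of 1 T] closed \<open>T > 0\<close> by simp
  next
    case False
    then show ?thesis using X_on[of 0 t] t by simp
  qed
  ultimately show ?thesis by blast
qed

section \<open>The Filippov map of the oscillator\<close>

definition friction :: "real \<Rightarrow> real \<Rightarrow> real \<Rightarrow> real \<Rightarrow> real \<Rightarrow> real" where
  "friction \<alpha> \<beta> \<gamma> \<epsilon> y = (1 - \<alpha>) / (1 + \<epsilon> * \<gamma> * y) + \<alpha> + \<epsilon> * \<beta> * y\<^sup>2"

lemma stribeck_oscillator_eq:
  "stribeck_oscillator \<alpha> \<beta> \<gamma> V c \<epsilon> p =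
     (snd p, - fst p - \<epsilon> * c * snd p - sgn (snd p - V) * friction \<alpha> \<beta> \<gamma> \<epsilon> \<bar>snd p - V\<bar>)"
  by (simp add: stribeck_oscillator_def friction_def case_prod_unfold)

lemma friction_0 [simp]: "friction \<alpha> \<beta> \<gamma> \<epsilon> 0 = 1"
  by (simp add: friction_def)

text \<open>The quadratic term only increases, so just the Stribeck term can decrease, and it does so at
  rate at most \<open>\<bar>1 - \<alpha>\<bar> \<epsilon> \<gamma>\<close>.\<close>

lemma friction_decrease_le:
  assumes "\<epsilon> > 0" "\<beta> > 0" "\<gamma> > 0" "0 \<le> y" "y \<le> z"
  shows "friction \<alpha> \<beta> \<gamma> \<epsilon> y - friction \<alpha> \<beta> \<gamma> \<epsilon> z \<le> \<bar>1 - \<alpha>\<bar> * (\<epsilon> * \<gamma>) * (z - y)"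
proof -
  define s where "s = \<epsilon> * \<gamma> * y"
  define r where "r = \<epsilon> * \<gamma> * z"
  have sr: "0 \<le> s" "s \<le> r" using assms by (auto simp: s_def r_def mult_left_mono)
  have "(1 - \<alpha>) / (1 + s) - (1 - \<alpha>) / (1 + r) = (1 - \<alpha>) * ((r - s) / ((1 + s) * (1 + r)))"
    using sr by (simp add: divide_simps) (simp add: algebra_simps)
  also have "\<dots> \<le> \<bar>1 - \<alpha>\<bar> * ((r - s) / 1)"
    using sr mult_mono[of 1 "1 + s" 1 "1 + r"] by (intro mult_mono divide_left_mono) auto
  finally have "(1 - \<alpha>) / (1 + s) - (1 - \<alpha>) / (1 + r) \<le> \<bar>1 - \<alpha>\<bar> * (r - s)" by simp
  moreover have "\<epsilon> * \<beta> * y\<^sup>2 \<le> \<epsilon> * \<beta> * z\<^sup>2"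
    using assms by (intro mult_left_mono power_mono) auto
  ultimately show ?thesis
    by (simp add: friction_def s_def[symmetric] r_def[symmetric]) (simp add: s_def r_def algebra_simps)
qed

context
  fixes \<alpha> \<beta> \<gamma> V c \<epsilon> :: real
begin

abbreviation (input) "osc \<equiv> stribeck_oscillator \<alpha> \<beta> \<gamma> V c \<epsilon>"

lemma friction_tendsto: "((\<lambda>y. friction \<alpha> \<beta> \<gamma> \<epsilon> \<bar>y - V\<bar>) \<longlongrightarrow> 1) (at V within S)"
  unfolding friction_def by (auto intro!: tendsto_eq_intros)

lemma lower_limit_oscillator: "lower_limit V osc s = (V, - s - \<epsilon> * c * V + 1)"
proof -
  have "((\<lambda>y. (y, - s - \<epsilon> * c * y + friction \<alpha> \<beta> \<gamma> \<epsilon> \<bar>y - V\<bar>)) \<longlongrightarrow> (V, - s - \<epsilon> * c * V + 1)) (at_left V)"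
    by (intro tendsto_intros friction_tendsto)
  moreover have "\<forall>\<^sub>F y in at_left V. (y, - s - \<epsilon> * c * y + friction \<alpha> \<beta> \<gamma> \<epsilon> \<bar>y - V\<bar>) = osc (s, y)"
    by (auto simp: stribeck_oscillator_eq eventually_at_filter)
  ultimately have "((\<lambda>y. osc (s, y)) \<longlongrightarrow> (V, - s - \<epsilon> * c * V + 1)) (at_left V)"
    by (rule Lim_transform_eventually)
  then show ?thesis unfolding lower_limit_def by (intro tendsto_Lim) auto
qed

lemma upper_limit_oscillator: "upper_limit V osc s = (V, - s - \<epsilon> * c * V - 1)"
proof -
  have "((\<lambda>y. (y, - s - \<epsilon> * c * y - friction \<alpha> \<beta> \<gamma> \<epsilon> \<bar>y - V\<bar>)) \<longlongrightarrow> (V, - s - \<epsilon> * c * V - 1)) (at_right V)"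
    by (intro tendsto_intros friction_tendsto)
  moreover have "\<forall>\<^sub>F y in at_right V. (y, - s - \<epsilon> * c * y - friction \<alpha> \<beta> \<gamma> \<epsilon> \<bar>y - V\<bar>) = osc (s, y)"
    by (auto simp: stribeck_oscillator_eq eventually_at_filter)
  ultimately have "((\<lambda>y. osc (s, y)) \<longlongrightarrow> (V, - s - \<epsilon> * c * V - 1)) (at_right V)"
    by (rule Lim_transform_eventually)
  then show ?thesis unfolding upper_limit_def by (intro tendsto_Lim) auto
qed

lemma filippov_map_oscillator_off_line:
  "y \<noteq> V \<Longrightarrow> v \<in> filippov_map V osc (s, y) \<longleftrightarrow>
     v = (y, - s - \<epsilon> * c * y - sgn (y - V) * friction \<alpha> \<beta> \<gamma> \<epsilon> \<bar>y - V\<bar>)"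
  by (simp add: filippov_map_def stribeck_oscillator_eq)

lemma filippov_map_oscillator_on_line:
  "v \<in> filippov_map V osc (s, V) \<longleftrightarrow> (\<exists>w. \<bar>w\<bar> \<le> 1 \<and> v = (V, - s - \<epsilon> * c * V - w))"
proof
  assume "v \<in> filippov_map V osc (s, V)"
  then obtain l where "l \<in> {0..1}" "v = l *\<^sub>R (V, - s - \<epsilon> * c * V + 1) + (1 - l) *\<^sub>R (V, - s - \<epsilon> * c * V - 1)"
    by (auto simp: filippov_map_def lower_limit_oscillator upper_limit_oscillator)
  then show "\<exists>w. \<bar>w\<bar> \<le> 1 \<and> v = (V, - s - \<epsilon> * c * V - w)"
    by (intro exI[of _ "1 - 2 * l"]) (auto simp: algebra_simps)
next
  assume "\<exists>w. \<bar>w\<bar> \<le> 1 \<and> v = (V, - s - \<epsilon> * c * V - w)"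
  then obtain w where w: "\<bar>w\<bar> \<le> 1" "v = (V, - s - \<epsilon> * c * V - w)" by blast
  define l where "l = (1 - w) / 2"
  have "v = l *\<^sub>R (V, - s - \<epsilon> * c * V + 1) + (1 - l) *\<^sub>R (V, - s - \<epsilon> * c * V - 1)"
    unfolding w(2) l_def by (simp add: field_simps)
  moreover have "l \<in> {0..1}" using w(1) by (auto simp: l_def)
  ultimately show "v \<in> filippov_map V osc (s, V)"
    by (auto simp: filippov_map_def lower_limit_oscillator upper_limit_oscillator)
qed

text \<open>The jump of the friction force at \<open>y = V\<close> and its quadratic part are monotone and only pull
  trajectories together; what can push them apart is the linear viscous term and the Stribeck term.\<close>

lemma one_sided_lipschitz_oscillator:
  assumes pos: "\<epsilon> > 0" "\<beta> > 0" "\<gamma> > 0"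
  shows "\<exists>L. one_sided_lipschitz L (filippov_map V osc)"
proof
  define M where "M = \<bar>1 - \<alpha>\<bar> * (\<epsilon> * \<gamma>)"
  define L where "L = \<bar>\<epsilon> * c\<bar> + M"
  have M: "M \<ge> 0" using pos by (simp add: M_def)
  \<comment> \<open>The graph of the set-valued friction law, as a function of the relative velocity.\<close>
  define Fr where "Fr = (\<lambda>y w. (y > 0 \<and> w = friction \<alpha> \<beta> \<gamma> \<epsilon> y) \<or> (y < 0 \<and> w = - friction \<alpha> \<beta> \<gamma> \<epsilon> (- y))
      \<or> (y = 0 \<and> \<bar>w\<bar> \<le> 1))"
  have force: "\<exists>w. Fr (snd p - V) w \<and> v = (snd p, - fst p - \<epsilon> * c * snd p - w)"
    if "v \<in> filippov_map V osc p" for p v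
  proof (cases "snd p = V")
    case True
    then show ?thesis using that filippov_map_oscillator_on_line[of v "fst p"]
      by (auto simp: Fr_def prod_eq_iff)
  next
    case False
    then have "v = (snd p, - fst p - \<epsilon> * c * snd p - sgn (snd p - V) * friction \<alpha> \<beta> \<gamma> \<epsilon> \<bar>snd p - V\<bar>)"
      using that filippov_map_oscillator_off_line[of "snd p" v "fst p"] by simp
    then show ?thesis using False
      by (intro exI[of _ "sgn (snd p - V) * friction \<alpha> \<beta> \<gamma> \<epsilon> \<bar>snd p - V\<bar>"]) (auto simp: Fr_def sgn_if)
  qed
  have dec: "friction \<alpha> \<beta> \<gamma> \<epsilon> y - friction \<alpha> \<beta> \<gamma> \<epsilon> z \<le> M * (z - y)" if "0 \<le> y" "y \<le> z" for y z
    unfolding M_def using friction_decrease_le[OF pos(1,2,3) that] .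
  have mono: "w' - w \<le> M * (y - y')" if "Fr y w" "Fr y' w'" "y' < y" for y y' w w'
    using that dec[of 0 y] dec[of y' y] dec[of 0 "- y'"] dec[of "- y" "- y'"]
    by (auto simp: Fr_def algebra_simps)
  have Fr: "- ((y - y') * (w - w')) \<le> M * (y - y')\<^sup>2" if "Fr y w" "Fr y' w'" for y y' w w'
  proof -
    consider "y' < y" | "y = y'" | "y < y'" by linarith
    then show ?thesis
    proof cases
      case 1
      have "(y - y') * (w' - w) \<le> (y - y') * (M * (y - y'))"
        using mono[OF that 1] 1 by (intro mult_left_mono) auto
      then show ?thesis by (simp add: power2_eq_square algebra_simps)
    next
      case 3
      have "(y' - y) * (w - w') \<le> (y' - y) * (M * (y' - y))"
        using mono[OF that(2,1) 3] 3 by (intro mult_left_mono) auto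
      then show ?thesis by (simp add: power2_eq_square algebra_simps)
    qed simp
  qed
  have "(p - q) \<bullet> (a - b) \<le> L * ((p - q) \<bullet> (p - q))"
    if ab: "a \<in> filippov_map V osc p" "b \<in> filippov_map V osc q" for p q a b
  proof -
    obtain w w' where w: "Fr (snd p - V) w" "a = (snd p, - fst p - \<epsilon> * c * snd p - w)"
      and w': "Fr (snd q - V) w'" "b = (snd q, - fst q - \<epsilon> * c * snd q - w')"
      using force[OF ab(1)] force[OF ab(2)] by blast
    let ?y = "snd p - snd q"
    have "(p - q) \<bullet> (a - b) = - (\<epsilon> * c) * ?y\<^sup>2 - ?y * (w - w')"
      by (simp add: w(2) w'(2) inner_prod_def power2_eq_square algebra_simps)
    also have "\<dots> \<le> \<bar>\<epsilon> * c\<bar> * ?y\<^sup>2 + M * ?y\<^sup>2"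
    proof -
      have "- (\<epsilon> * c) * ?y\<^sup>2 \<le> \<bar>\<epsilon> * c\<bar> * ?y\<^sup>2" by (intro mult_right_mono) auto
      then show ?thesis using Fr[OF w(1) w'(1)] by simp
    qed
    also have "\<dots> \<le> L * ((fst p - fst q)\<^sup>2 + ?y\<^sup>2)"
      using M by (simp add: L_def algebra_simps)
    finally show ?thesis by (simp add: inner_prod_def power2_eq_square)
  qed
  then show "one_sided_lipschitz L (filippov_map V osc)"
    using M by (auto simp: one_sided_lipschitz_def L_def)
qed

end

section \<open>Energy gain of the slip phase\<close>

lemma DERIV_nonneg_imp_nondecreasing_within:
  fixes f :: "real \<Rightarrow> real"
  assumes "a \<le> b"
    and "\<And>t. t \<in> {a..b} \<Longrightarrow> \<exists>D\<ge>0. (f has_real_derivative D) (at t within {a..b})"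
  shows "f a \<le> f b"
proof -
  obtain f' where f': "\<And>t. t \<in> {a..b} \<Longrightarrow> f' t \<ge> 0"
    "\<And>t. t \<in> {a..b} \<Longrightarrow> (f has_real_derivative f' t) (at t within {a..b})"
    using assms(2) by metis
  have "\<exists>t\<in>{a..b}. f b - f a = (\<lambda>h. f' t * h) (b - a)"
    using f'(2) by (intro mvt_very_simple[OF \<open>a \<le> b\<close>]) (simp add: has_field_derivative_def)
  then obtain t where "t \<in> {a..b}" "f b - f a = f' t * (b - a)" by blast
  moreover have "f' t * (b - a) \<ge> 0"
    using f'(1)[OF \<open>t \<in> {a..b}\<close>] assms(1) by simp
  ultimately show ?thesis by linarith
qed

text \<open>Below the line, with \<open>u = x\<^sub>1 - 1\<close> and \<open>v = x\<^sub>2\<close>, the system is a harmonic oscillator with the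
  perturbation \<open>\<epsilon> h\<close>: \<open>u' = v\<close> and \<open>v' = - u + \<epsilon> h \<epsilon> v\<close>.\<close>

locale stribeck =
  fixes \<alpha> \<beta> \<gamma> V c :: real
  assumes \<alpha>: "\<alpha> > 0" and \<beta>: "\<beta> > 0" and \<gamma>: "\<gamma> > 0" and V: "V > 0"
    and averaged_gain: "- c + \<gamma> * (1 - \<alpha>) - 2 * \<beta> * V > 0"
begin

text \<open>As \<open>\<epsilon>\<close> tends to 0, the perturbation becomes \<open>a0 + \<kappa> v + \<beta> v\<^sup>2\<close>. Only its middle term does
  work over a full turn of a circle, which is why \<open>\<kappa>\<close> alone decides between gain and loss.\<close>

definition \<kappa> :: real where "\<kappa> = - c + \<gamma> * (1 - \<alpha>) - 2 * \<beta> * V"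

definition a0 :: real where "a0 = \<beta> * V\<^sup>2 - (1 - \<alpha>) * \<gamma> * V"

definition h :: "real \<Rightarrow> real \<Rightarrow> real" where
  "h \<epsilon> v = - c * v - (1 - \<alpha>) * \<gamma> * ((V - v) / (1 + \<epsilon> * \<gamma> * (V - v))) + \<beta> * (V - v)\<^sup>2"

text \<open>\<open>M\<close> bounds \<open>h\<close>, and \<open>R\<close> the remainder of its expansion in \<open>\<epsilon>\<close>, for velocities between \<open>- 2 V\<close> and
  \<open>V\<close>, that is for relative velocities up to \<open>3 V\<close>, uniformly in \<open>\<epsilon>\<close>.\<close>

definition M :: real where "M = \<bar>c\<bar> * (2 * V) + \<bar>1 - \<alpha>\<bar> * \<gamma> * (3 * V) + \<beta> * (3 * V)\<^sup>2"

definition R :: real where "R = \<bar>1 - \<alpha>\<bar> * \<gamma>\<^sup>2 * (3 * V)\<^sup>2"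

lemma \<kappa>_pos: "\<kappa> > 0"
  using averaged_gain by (simp add: \<kappa>_def)

lemma M_nonneg: "M \<ge> 0"
  using V \<beta> \<gamma> by (auto simp: M_def intro!: add_nonneg_nonneg mult_nonneg_nonneg)

lemma h_V: "h \<epsilon> V = - c * V"
  by (simp add: h_def)

lemma h_eq_friction:
  assumes "\<epsilon> > 0" "v \<le> V"
  shows "1 + \<epsilon> * h \<epsilon> v = friction \<alpha> \<beta> \<gamma> \<epsilon> (V - v) - \<epsilon> * c * v"
proof -
  define y where "y = V - v"
  have "\<epsilon> * \<gamma> * y \<ge> 0" using assms \<gamma> by (simp add: y_def)
  then show ?thesis
    unfolding h_def friction_def y_def[symmetric] by (simp add: divide_simps) (simp add: algebra_simps)
qed

lemma saturated_bounds:
  assumes "\<epsilon> > 0" "0 \<le> y" "y \<le> 3 * V"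
  shows "0 \<le> y / (1 + \<epsilon> * \<gamma> * y)" "y / (1 + \<epsilon> * \<gamma> * y) \<le> 3 * V"
proof -
  have "\<epsilon> * \<gamma> * y \<ge> 0" using assms \<gamma> by simp
  then show "0 \<le> y / (1 + \<epsilon> * \<gamma> * y)" using assms(2) by simp
  have "y / (1 + \<epsilon> * \<gamma> * y) \<le> y / 1"
    using \<open>\<epsilon> * \<gamma> * y \<ge> 0\<close> assms(2) by (intro divide_left_mono) auto
  then show "y / (1 + \<epsilon> * \<gamma> * y) \<le> 3 * V" using assms(3) by simp
qed

lemma h_bound:
  assumes "\<epsilon> > 0" "v \<in> {- 2 * V..V}"
  shows "\<bar>h \<epsilon> v\<bar> \<le> M"
proof -
  let ?y = "V - v"
  have y: "0 \<le> ?y" "?y \<le> 3 * V" using assms by auto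
  have "\<bar>c * v\<bar> \<le> \<bar>c\<bar> * (2 * V)"
    unfolding abs_mult using assms V by (intro mult_left_mono) auto
  moreover have "\<bar>(1 - \<alpha>) * \<gamma> * (?y / (1 + \<epsilon> * \<gamma> * ?y))\<bar> \<le> \<bar>1 - \<alpha>\<bar> * \<gamma> * (3 * V)"
    unfolding abs_mult abs_of_nonneg[OF saturated_bounds(1)[OF assms(1) y]]
    using \<gamma> saturated_bounds[OF assms(1) y] by (intro mult_mono) auto
  moreover have "\<bar>\<beta> * ?y\<^sup>2\<bar> \<le> \<beta> * (3 * V)\<^sup>2"
    unfolding abs_mult using \<beta> y power_mono[OF y(2,1), of 2] by (intro mult_mono) auto
  ultimately show ?thesis unfolding h_def M_def by (simp only: mult_minus_left)
qed

lemma h_lipschitz: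
  assumes "\<epsilon> > 0" "v \<in> {- 2 * V..V}" "w \<in> {- 2 * V..V}"
  shows "\<bar>h \<epsilon> v - h \<epsilon> w\<bar> \<le> (\<bar>c\<bar> + \<bar>1 - \<alpha>\<bar> * \<gamma> + \<beta> * (6 * V)) * \<bar>v - w\<bar>"
proof -
  define y where "y = V - v"
  define z where "z = V - w"
  have y: "0 \<le> y" "y \<le> 3 * V" and z: "0 \<le> z" "z \<le> 3 * V" using assms by (auto simp: y_def z_def)
  have yz: "\<epsilon> * \<gamma> * y \<ge> 0" "\<epsilon> * \<gamma> * z \<ge> 0" using assms(1) \<gamma> y z by simp_all
  have "1 * 1 \<le> (1 + \<epsilon> * \<gamma> * y) * (1 + \<epsilon> * \<gamma> * z)" using yz by (intro mult_mono) auto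
  moreover have "y / (1 + \<epsilon> * \<gamma> * y) - z / (1 + \<epsilon> * \<gamma> * z) = (y - z) / ((1 + \<epsilon> * \<gamma> * y) * (1 + \<epsilon> * \<gamma> * z))"
    using yz by (simp add: divide_simps) (simp add: algebra_simps)
  ultimately have "\<bar>y / (1 + \<epsilon> * \<gamma> * y) - z / (1 + \<epsilon> * \<gamma> * z)\<bar> \<le> \<bar>y - z\<bar> / 1"
    by (simp only: abs_divide) (intro divide_left_mono, auto)
  then have 1: "\<bar>(1 - \<alpha>) * \<gamma> * (y / (1 + \<epsilon> * \<gamma> * y) - z / (1 + \<epsilon> * \<gamma> * z))\<bar> \<le> \<bar>1 - \<alpha>\<bar> * \<gamma> * \<bar>y - z\<bar>"
    unfolding abs_mult using \<gamma> by (intro mult_mono) auto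
  have "\<bar>\<beta> * ((y + z) * (y - z))\<bar> \<le> \<beta> * ((6 * V) * \<bar>y - z\<bar>)"
    unfolding abs_mult using \<beta> V y z by (intro mult_mono) auto
  moreover have "h \<epsilon> v - h \<epsilon> w = c * (y - z) - (1 - \<alpha>) * \<gamma> * (y / (1 + \<epsilon> * \<gamma> * y) - z / (1 + \<epsilon> * \<gamma> * z))
      + \<beta> * ((y + z) * (y - z))"
    unfolding h_def y_def[symmetric] z_def[symmetric]
    by (simp add: power2_eq_square algebra_simps) (simp add: y_def z_def algebra_simps)
  ultimately have "\<bar>h \<epsilon> v - h \<epsilon> w\<bar> \<le> \<bar>c\<bar> * \<bar>y - z\<bar> + \<bar>1 - \<alpha>\<bar> * \<gamma> * \<bar>y - z\<bar> + \<beta> * ((6 * V) * \<bar>y - z\<bar>)"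
    using 1 abs_mult[of c "y - z"] by linarith
  then show ?thesis by (simp add: y_def z_def abs_minus_commute algebra_simps)
qed

lemma h_expansion:
  assumes "\<epsilon> > 0" "v \<in> {- 2 * V..V}"
  obtains r where "\<bar>r\<bar> \<le> R" "h \<epsilon> v = a0 + \<kappa> * v + \<beta> * v\<^sup>2 + \<epsilon> * r"
proof
  define y where "y = V - v"
  define r where "r = (1 - \<alpha>) * \<gamma>\<^sup>2 * (y\<^sup>2 / (1 + \<epsilon> * \<gamma> * y))"
  have y: "0 \<le> y" "y \<le> 3 * V" using assms by (auto simp: y_def)
  have sy: "\<epsilon> * \<gamma> * y \<ge> 0" using assms(1) \<gamma> y by simp
  have "y\<^sup>2 / (1 + \<epsilon> * \<gamma> * y) \<le> y\<^sup>2 / 1" using sy by (intro divide_left_mono) auto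
  also have "\<dots> \<le> (3 * V)\<^sup>2" using power_mono[OF y(2,1), of 2] by simp
  finally show "\<bar>r\<bar> \<le> R"
    unfolding r_def R_def abs_mult using sy by (intro mult_mono) auto
  have "y / (1 + \<epsilon> * \<gamma> * y) = y - \<epsilon> * \<gamma> * (y\<^sup>2 / (1 + \<epsilon> * \<gamma> * y))"
    using sy by (simp add: divide_simps) (simp add: power2_eq_square algebra_simps)
  then have "h \<epsilon> v = - c * v - (1 - \<alpha>) * \<gamma> * (y - \<epsilon> * \<gamma> * (y\<^sup>2 / (1 + \<epsilon> * \<gamma> * y))) + \<beta> * y\<^sup>2"
    unfolding h_def y_def[symmetric] by simp
  also have "\<dots> = - c * v - (1 - \<alpha>) * \<gamma> * y + \<beta> * y\<^sup>2 + \<epsilon> * r"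
    by (simp add: r_def power2_eq_square algebra_simps)
  also have "- c * v - (1 - \<alpha>) * \<gamma> * y + \<beta> * y\<^sup>2 = a0 + \<kappa> * v + \<beta> * v\<^sup>2"
    by (simp add: y_def a0_def \<kappa>_def power2_eq_square algebra_simps)
  finally show "h \<epsilon> v = a0 + \<kappa> * v + \<beta> * v\<^sup>2 + \<epsilon> * r" .
qed

text \<open>Clipping the velocity makes the vector field globally Lipschitz and bounds the perturbation in advance.
  Solutions will turn out to stay above \<open>- 2 V\<close>, and the clipping at \<open>V\<close> matters only after the
  line has been reached.\<close>

definition clip :: "real \<Rightarrow> real" where "clip v = max (- 2 * V) (min v V)"

lemma clip_bounds: "clip v \<in> {- 2 * V..V}"
  using V by (auto simp: clip_def)

lemma clip_id: "v \<in> {- 2 * V..V} \<Longrightarrow> clip v = v"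
  by (auto simp: clip_def)

lemma clip_diff_le: "\<bar>clip v - clip w\<bar> \<le> \<bar>v - w\<bar>"
  using V by (auto simp: clip_def max_def min_def)

lemma clipped_h_lipschitz:
  assumes "\<epsilon> > 0"
  obtains L where "L \<ge> 0" "\<And>v w. \<bar>h \<epsilon> (clip v) - h \<epsilon> (clip w)\<bar> \<le> L * \<bar>v - w\<bar>"
proof
  let ?L = "\<bar>c\<bar> + \<bar>1 - \<alpha>\<bar> * \<gamma> + \<beta> * (6 * V)"
  show "?L \<ge> 0" using \<beta> \<gamma> V by simp
  fix v w
  have "\<bar>h \<epsilon> (clip v) - h \<epsilon> (clip w)\<bar> \<le> ?L * \<bar>clip v - clip w\<bar>"
    using h_lipschitz[OF assms clip_bounds clip_bounds] .
  also have "\<dots> \<le> ?L * \<bar>v - w\<bar>" using \<open>?L \<ge> 0\<close> clip_diff_le by (intro mult_left_mono)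
  finally show "\<bar>h \<epsilon> (clip v) - h \<epsilon> (clip w)\<bar> \<le> ?L * \<bar>v - w\<bar>" .
qed

text \<open>The start is the end point \<open>(1 - \<epsilon> c V, V)\<close> of the sliding segment in the shifted coordinates.\<close>

definition clipped_flow :: "real \<Rightarrow> (real \<Rightarrow> real) \<Rightarrow> (real \<Rightarrow> real) \<Rightarrow> bool" where
  "clipped_flow \<epsilon> u v \<longleftrightarrow> u 0 = - \<epsilon> * c * V \<and> v 0 = V \<and> (\<forall>t\<in>{0..2 * pi}.
     (u has_real_derivative v t) (at t within {0..2 * pi}) \<and>
     (v has_real_derivative - u t + \<epsilon> * h \<epsilon> (clip (v t))) (at t within {0..2 * pi}))"

lemma clipped_flow_exists:
  assumes "\<epsilon> > 0"
  shows "\<exists>u v. clipped_flow \<epsilon> u v"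
proof -
  obtain L where L: "L \<ge> 0" "\<And>v w. \<bar>h \<epsilon> (clip v) - h \<epsilon> (clip w)\<bar> \<le> L * \<bar>v - w\<bar>"
    using clipped_h_lipschitz[OF assms] by blast
  define F where "F = (\<lambda>p::real \<times> real. (snd p, - fst p + \<epsilon> * h \<epsilon> (clip (snd p))))"
  have "(2 + \<epsilon> * L)-lipschitz_on UNIV F"
  proof (rule lipschitz_onI)
    fix p q :: "real \<times> real"
    have 1: "\<bar>fst p - fst q\<bar> \<le> dist p q" "\<bar>snd p - snd q\<bar> \<le> dist p q"
      using dist_fst_le[of p q] dist_snd_le[of p q] by (auto simp: dist_real_def)
    have "\<bar>- fst p + \<epsilon> * h \<epsilon> (clip (snd p)) - (- fst q + \<epsilon> * h \<epsilon> (clip (snd q)))\<bar>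
        \<le> \<bar>fst p - fst q\<bar> + \<epsilon> * \<bar>h \<epsilon> (clip (snd p)) - h \<epsilon> (clip (snd q))\<bar>"
    proof -
      have "- fst p + \<epsilon> * h \<epsilon> (clip (snd p)) - (- fst q + \<epsilon> * h \<epsilon> (clip (snd q)))
          = (fst q - fst p) + \<epsilon> * (h \<epsilon> (clip (snd p)) - h \<epsilon> (clip (snd q)))" by algebra
      then show ?thesis
        using abs_triangle_ineq[of "fst q - fst p" "\<epsilon> * (h \<epsilon> (clip (snd p)) - h \<epsilon> (clip (snd q)))"] assms
        by (simp add: abs_mult)
    qed
    also have "\<dots> \<le> dist p q + \<epsilon> * (L * dist p q)"
    proof -
      have "\<bar>h \<epsilon> (clip (snd p)) - h \<epsilon> (clip (snd q))\<bar> \<le> L * dist p q"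
        using L(2)[of "snd p" "snd q"] mult_left_mono[OF 1(2) L(1)] by linarith
      then show ?thesis using assms 1(1) by (intro add_mono mult_left_mono) auto
    qed
    finally have 2: "dist (snd (F p)) (snd (F q)) \<le> dist p q + \<epsilon> * (L * dist p q)"
      by (simp add: F_def dist_real_def)
    have "dist (F p) (F q) \<le> dist (fst (F p)) (fst (F q)) + dist (snd (F p)) (snd (F q))"
      unfolding dist_prod_def by (rule sqrt_sum_squares_le_sum) auto
    also have "\<dots> \<le> dist p q + (dist p q + \<epsilon> * (L * dist p q))"
      using 1(2) 2 by (intro add_mono) (simp_all add: F_def dist_real_def)
    finally show "dist (F p) (F q) \<le> (2 + \<epsilon> * L) * dist p q" by (simp add: algebra_simps)
  qed (use assms L in auto)
  then have "\<exists>z. z 0 = (- \<epsilon> * c * V, V) \<and>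
      (\<forall>t\<in>{0..2 * pi}. (z has_vector_derivative F (z t)) (at t within {0..2 * pi}))"
    by (rule picard_lindelof_lipschitz) simp
  then obtain z where z: "z 0 = (- \<epsilon> * c * V, V)"
    "\<And>t. t \<in> {0..2 * pi} \<Longrightarrow> (z has_vector_derivative F (z t)) (at t within {0..2 * pi})"
    by blast
  have "clipped_flow \<epsilon> (\<lambda>t. fst (z t)) (\<lambda>t. snd (z t))"
    using bounded_linear.has_vector_derivative[OF bounded_linear_fst z(2)]
      bounded_linear.has_vector_derivative[OF bounded_linear_snd z(2)] z(1)
    by (auto simp: clipped_flow_def has_real_derivative_iff_has_vector_derivative F_def)
  then show ?thesis by blast
qed

definition K :: real where "K = \<bar>c\<bar> * V + 2 * pi * M"

lemma K_nonneg: "K \<ge> 0"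
  using V M_nonneg by (simp add: K_def)

text \<open>In coordinates that rotate with the unperturbed oscillator only the perturbation moves the point, so
  over one turn it drifts by \<open>O(\<epsilon>)\<close>. The summand \<open>\<bar>c\<bar> V\<close> of \<open>K\<close> accounts for the starting point.\<close>

lemma rotating_frame_bounds:
  assumes "\<epsilon> > 0" and flow: "clipped_flow \<epsilon> u v" and t: "t \<in> {0..2 * pi}"
  shows "\<bar>u t * cos t - v t * sin t\<bar> \<le> K * \<epsilon>" "\<bar>u t * sin t + v t * cos t - V\<bar> \<le> K * \<epsilon>"
proof -
  have drift: "\<bar>g t - g 0\<bar> \<le> 2 * pi * M * \<epsilon>"
    if g: "\<And>s. s \<in> {0..2 * pi} \<Longrightarrow> (g has_real_derivative \<epsilon> * h \<epsilon> (clip (v s)) * k s) (at s within {0..2 * pi})"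
      and k: "\<And>s. \<bar>k s\<bar> \<le> 1" for g k
  proof -
    have "(\<epsilon> * M)-lipschitz_on {0..2 * pi} g"
    proof (rule lipschitz_on_of_derivative_bound)
      show "(g has_vector_derivative \<epsilon> * h \<epsilon> (clip (v s)) * k s) (at s within {0..2 * pi})"
        if "s \<in> {0..2 * pi}" for s
        using g[OF that] by (simp add: has_real_derivative_iff_has_vector_derivative)
      show "norm (\<epsilon> * h \<epsilon> (clip (v s)) * k s) \<le> \<epsilon> * M" for s
      proof -
        have "\<bar>h \<epsilon> (clip (v s))\<bar> * \<bar>k s\<bar> \<le> M * 1"
          using h_bound[OF assms(1) clip_bounds] k M_nonneg by (intro mult_mono) auto
        then show ?thesis using assms(1) by (simp add: abs_mult mult.assoc)
      qed
    qed (use assms(1) M_nonneg in auto)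
    from lipschitz_onD[OF this t, of 0] have "\<bar>g t - g 0\<bar> \<le> \<epsilon> * M * t"
      using t by (simp add: dist_real_def)
    also have "\<dots> \<le> \<epsilon> * M * (2 * pi)"
      using t assms(1) M_nonneg by (intro mult_left_mono) auto
    finally show ?thesis by (simp add: mult_ac)
  qed
  have cV: "\<bar>\<epsilon> * c * V\<bar> = \<bar>c\<bar> * V * \<epsilon>" using assms(1) V by (simp add: abs_mult)
  have du: "(u has_real_derivative v s) (at s within {0..2 * pi})"
    and dv: "(v has_real_derivative - u s + \<epsilon> * h \<epsilon> (clip (v s))) (at s within {0..2 * pi})"
    if "s \<in> {0..2 * pi}" for s
    using flow that by (auto simp: clipped_flow_def)
  have "\<bar>(u t * cos t - v t * sin t) - (u 0 * cos 0 - v 0 * sin 0)\<bar> \<le> 2 * pi * M * \<epsilon>"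
  proof (rule drift[where k = "\<lambda>s. - sin s"])
    fix s assume s: "s \<in> {0..2 * pi}"
    show "((\<lambda>t. u t * cos t - v t * sin t) has_real_derivative \<epsilon> * h \<epsilon> (clip (v s)) * - sin s) (at s within {0..2 * pi})"
      by (rule derivative_eq_intros du[OF s] dv[OF s] refl | simp add: algebra_simps)+
  qed simp
  moreover have "u 0 = - (\<epsilon> * c * V)" using flow by (simp add: clipped_flow_def)
  ultimately have "\<bar>(u t * cos t - v t * sin t) + \<epsilon> * c * V\<bar> \<le> 2 * pi * M * \<epsilon>" by simp
  then show "\<bar>u t * cos t - v t * sin t\<bar> \<le> K * \<epsilon>"
    using cV unfolding K_def distrib_right by linarith
  have "\<bar>(u t * sin t + v t * cos t) - (u 0 * sin 0 + v 0 * cos 0)\<bar> \<le> 2 * pi * M * \<epsilon>"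
  proof (rule drift[where k = "\<lambda>s. cos s"])
    fix s assume s: "s \<in> {0..2 * pi}"
    show "((\<lambda>t. u t * sin t + v t * cos t) has_real_derivative \<epsilon> * h \<epsilon> (clip (v s)) * cos s) (at s within {0..2 * pi})"
      by (rule derivative_eq_intros du[OF s] dv[OF s] refl | simp add: algebra_simps)+
  qed simp
  moreover have "v 0 = V" using flow by (simp add: clipped_flow_def)
  ultimately have "\<bar>u t * sin t + v t * cos t - V\<bar> \<le> 2 * pi * M * \<epsilon>" by simp
  moreover have "0 \<le> \<bar>c\<bar> * V * \<epsilon>" using V assms(1) by simp
  ultimately show "\<bar>u t * sin t + v t * cos t - V\<bar> \<le> K * \<epsilon>"
    unfolding K_def distrib_right by linarith
qed

text \<open>\<open>W\<close> is the energy with an averaging correction of order \<open>\<epsilon>\<close>. Along the unperturbed rotation,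
  \<open>v\<close>, \<open>v\<^sup>2 - (u\<^sup>2 + v\<^sup>2) / 2\<close> and \<open>v\<^sup>3\<close> are the derivatives of \<open>u\<close>, \<open>u v / 2\<close> and
  \<open>u v\<^sup>2 + 2 u\<^sup>3 / 3\<close>; subtracting these primitives cancels the oscillating part of the power
  \<open>\<epsilon> v (a0 + \<kappa> v + \<beta> v\<^sup>2)\<close> and leaves its mean \<open>\<epsilon> \<kappa> (u\<^sup>2 + v\<^sup>2) / 2\<close>. \<open>S0\<close> bounds the resulting
  error of order \<open>\<epsilon>\<^sup>2\<close>.\<close>

definition S0 :: real where "S0 = 2 * V * R + \<kappa> * V * M + 8 * \<beta> * V\<^sup>2 * M"

definition W :: "real \<Rightarrow> real \<Rightarrow> real \<Rightarrow> real" where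
  "W \<epsilon> u v = (u\<^sup>2 + v\<^sup>2) / 2 - \<epsilon> * (u * (a0 + \<kappa> * v / 2 + \<beta> * (v\<^sup>2 + 2 * u\<^sup>2 / 3)))"

text \<open>Thus \<open>W\<close> grows at every instant, not only on average. The margin \<open>\<kappa> V\<^sup>2 / 16\<close> is half of what the
  mean power provides when \<open>u\<^sup>2 + v\<^sup>2 \<ge> V\<^sup>2 / 4\<close>; the other half absorbs the error.\<close>

lemma W_growth:
  assumes "\<epsilon> > 0" and small: "\<epsilon> * S0 \<le> \<kappa> * V\<^sup>2 / 16" and "0 \<le> s"
    and du: "\<And>t. t \<in> {0..s} \<Longrightarrow> (u has_real_derivative v t) (at t within {0..s})"
    and dv: "\<And>t. t \<in> {0..s} \<Longrightarrow> (v has_real_derivative - u t + \<epsilon> * h \<epsilon> (v t)) (at t within {0..s})"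
    and box: "\<And>t. t \<in> {0..s} \<Longrightarrow> \<bar>u t\<bar> \<le> 2 * V" "\<And>t. t \<in> {0..s} \<Longrightarrow> v t \<in> {- 2 * V..V}"
    and E: "\<And>t. t \<in> {0..s} \<Longrightarrow> V\<^sup>2 / 4 \<le> (u t)\<^sup>2 + (v t)\<^sup>2"
  shows "W \<epsilon> (u 0) (v 0) + \<epsilon> * (\<kappa> * V\<^sup>2 / 16) * s \<le> W \<epsilon> (u s) (v s)"
proof -
  let ?k = "\<epsilon> * (\<kappa> * V\<^sup>2 / 16)"
  have "W \<epsilon> (u 0) (v 0) - ?k * 0 \<le> W \<epsilon> (u s) (v s) - ?k * s"
  proof (rule DERIV_nonneg_imp_nondecreasing_within[OF \<open>0 \<le> s\<close>])
    fix t assume t: "t \<in> {0..s}"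
    define H where "H = h \<epsilon> (v t)"
    obtain r where r: "\<bar>r\<bar> \<le> R" "H = a0 + \<kappa> * v t + \<beta> * (v t)\<^sup>2 + \<epsilon> * r"
      unfolding H_def using h_expansion[OF assms(1) box(2)[OF t]] by metis
    let ?S = "v t * r - \<kappa> * (u t * H) / 2 - 2 * \<beta> * (u t * (v t * H))"
    let ?D = "\<epsilon> * (\<kappa> * ((u t)\<^sup>2 + (v t)\<^sup>2) / 2) + \<epsilon> * (\<epsilon> * ?S) - ?k"
    have "((\<lambda>t. W \<epsilon> (u t) (v t) - ?k * t) has_real_derivative
        u t * v t + v t * (- u t + \<epsilon> * H)
        - \<epsilon> * (v t * (a0 + \<kappa> * v t / 2 + \<beta> * ((v t)\<^sup>2 + 2 * (u t)\<^sup>2 / 3))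
             + u t * (\<kappa> * (- u t + \<epsilon> * H) / 2 + \<beta> * (2 * v t * (- u t + \<epsilon> * H) + 4 * u t * v t / 3))) - ?k)
        (at t within {0..s})"
      unfolding W_def H_def
      by (rule derivative_eq_intros du[OF t] dv[OF t] refl | simp add: field_simps)+
    also have "u t * v t + v t * (- u t + \<epsilon> * H)
        - \<epsilon> * (v t * (a0 + \<kappa> * v t / 2 + \<beta> * ((v t)\<^sup>2 + 2 * (u t)\<^sup>2 / 3))
             + u t * (\<kappa> * (- u t + \<epsilon> * H) / 2 + \<beta> * (2 * v t * (- u t + \<epsilon> * H) + 4 * u t * v t / 3))) - ?k
        = \<epsilon> * (v t * (H - a0 - \<kappa> * v t - \<beta> * (v t)\<^sup>2)) + \<epsilon> * (\<kappa> * ((u t)\<^sup>2 + (v t)\<^sup>2) / 2)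
          - \<epsilon> * (\<epsilon> * (\<kappa> * (u t * H) / 2 + 2 * \<beta> * (u t * (v t * H)))) - ?k"
      by (simp add: power2_eq_square field_simps)
    also have "\<dots> = ?D" unfolding r(2)[THEN arg_cong, of "\<lambda>H. H - a0 - \<kappa> * v t - \<beta> * (v t)\<^sup>2"]
      by (simp add: algebra_simps)
    finally have "((\<lambda>t. W \<epsilon> (u t) (v t) - ?k * t) has_real_derivative ?D) (at t within {0..s})" .
    moreover have "?D \<ge> 0"
    proof -
      have H: "\<bar>H\<bar> \<le> M" unfolding H_def using h_bound[OF assms(1) box(2)[OF t]] .
      have v: "\<bar>v t\<bar> \<le> 2 * V" using box(2)[OF t] by auto
      have "\<bar>v t * r\<bar> \<le> (2 * V) * R" unfolding abs_mult using v r(1) V by (intro mult_mono) auto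
      moreover have uH: "\<bar>u t * H\<bar> \<le> (2 * V) * M"
        unfolding abs_mult using box(1)[OF t] H V by (intro mult_mono) auto
      then have "\<bar>\<kappa> * (u t * H)\<bar> \<le> \<kappa> * ((2 * V) * M)"
        unfolding abs_mult[of \<kappa>] using \<kappa>_pos by (intro mult_mono) auto
      moreover have "\<bar>v t * (u t * H)\<bar> \<le> (2 * V) * ((2 * V) * M)"
        unfolding abs_mult[of "v t"] using v uH V by (intro mult_mono) auto
      then have "\<bar>2 * \<beta> * (u t * (v t * H))\<bar> \<le> 2 * \<beta> * ((2 * V) * ((2 * V) * M))"
        unfolding abs_mult[of "2 * \<beta>"] using \<beta> by (intro mult_mono) (auto simp: mult.left_commute)
      ultimately have "\<bar>?S\<bar> \<le> S0" by (simp add: S0_def power2_eq_square)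
      then have "\<epsilon> * \<bar>?S\<bar> \<le> \<kappa> * V\<^sup>2 / 16"
        using small assms(1) mult_left_mono[of "\<bar>?S\<bar>" S0 \<epsilon>] by linarith
      then have "\<bar>\<epsilon> * ?S\<bar> \<le> \<kappa> * V\<^sup>2 / 16" using assms(1) by (simp add: abs_mult)
      moreover have "\<kappa> * (V\<^sup>2 / 4) / 2 \<le> \<kappa> * ((u t)\<^sup>2 + (v t)\<^sup>2) / 2"
        using E[OF t] \<kappa>_pos by (intro divide_right_mono mult_left_mono) auto
      then have "2 * (\<kappa> * V\<^sup>2 / 16) \<le> \<kappa> * ((u t)\<^sup>2 + (v t)\<^sup>2) / 2" by simp
      moreover have "0 \<le> A + B - C" if "\<bar>B\<bar> \<le> C" "2 * C \<le> A" for A B C :: real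
        using that by linarith
      ultimately have "0 \<le> \<kappa> * ((u t)\<^sup>2 + (v t)\<^sup>2) / 2 + \<epsilon> * ?S - \<kappa> * V\<^sup>2 / 16"
        by blast
      then have "0 \<le> \<epsilon> * (\<kappa> * ((u t)\<^sup>2 + (v t)\<^sup>2) / 2 + \<epsilon> * ?S - \<kappa> * V\<^sup>2 / 16)"
        using assms(1) by (intro mult_nonneg_nonneg) auto
      then show ?thesis by (simp only: distrib_left right_diff_distrib)
    qed
    ultimately show "\<exists>D\<ge>0. ((\<lambda>t. W \<epsilon> (u t) (v t) - ?k * t) has_real_derivative D) (at t within {0..s})" by blast
  qed
  then show ?thesis by simp
qed


text \<open>Bounds the factor of \<open>\<epsilon> u\<close> in the correction term of \<open>W\<close>.\<close>

definition G0 :: real where "G0 = \<bar>a0\<bar> + \<kappa> * V + 7 * \<beta> * V\<^sup>2"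

text \<open>In order: the orbit stays in the region where the bounds hold; \<open>W\<close> grows; its growth over one turn
  exceeds the corrections at both ends, which are of order \<open>\<epsilon>\<^sup>2\<close>; the arc returns to the line at
  distance less than 1 from \<open>u = 0\<close>; and the sliding segment contains all points with \<open>\<bar>u\<bar> < 1\<close>
  to the left of its end.\<close>

definition small :: "real \<Rightarrow> bool" where
  "small \<epsilon> \<longleftrightarrow> \<epsilon> > 0 \<and> K * \<epsilon> \<le> V / 2 \<and> \<epsilon> * S0 \<le> \<kappa> * V\<^sup>2 / 16
     \<and> \<epsilon> * (4 * K * G0 + K\<^sup>2) < 4 * pi * (\<kappa> * V\<^sup>2 / 16)
     \<and> 2 * (K * \<epsilon>)\<^sup>2 + 2 * V * (K * \<epsilon>) < 1 \<and> \<bar>c\<bar> * V * \<epsilon> < 1"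

lemma eventually_small: "eventually small (at_right 0)"
proof -
  have lt: "\<forall>\<^sub>F \<epsilon> in at_right 0. g \<epsilon> < B" if "continuous (at_right 0) g" "g 0 < B" for g :: "real \<Rightarrow> real" and B
    using that by (auto simp: continuous_within intro: order_tendstoD(2))
  have pos: "0 < V / 2" "0 < \<kappa> * V\<^sup>2 / 16" using V \<kappa>_pos by auto
  have "\<forall>\<^sub>F \<epsilon> in at_right 0. K * \<epsilon> < V / 2"
    using pos by (intro lt continuous_intros) simp
  moreover have "\<forall>\<^sub>F \<epsilon> in at_right 0. \<epsilon> * S0 < \<kappa> * V\<^sup>2 / 16"
    using pos by (intro lt continuous_intros) simp
  moreover have "\<forall>\<^sub>F \<epsilon> in at_right 0. \<epsilon> * (4 * K * G0 + K\<^sup>2) < 4 * pi * (\<kappa> * V\<^sup>2 / 16)"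
  proof (intro lt continuous_intros)
    have "0 < 4 * pi * (\<kappa> * V\<^sup>2 / 16)" using pos(2) by (intro mult_pos_pos) auto
    then show "0 * (4 * K * G0 + K\<^sup>2) < 4 * pi * (\<kappa> * V\<^sup>2 / 16)" by simp
  qed
  moreover have "\<forall>\<^sub>F \<epsilon> in at_right 0. 2 * (K * \<epsilon>)\<^sup>2 + 2 * V * (K * \<epsilon>) < 1"
    by (intro lt continuous_intros) simp
  moreover have "\<forall>\<^sub>F \<epsilon> in at_right 0. \<bar>c\<bar> * V * \<epsilon> < 1"
    by (intro lt continuous_intros) simp
  moreover note eventually_at_right_less[of "0::real"]
  ultimately show ?thesis
    unfolding small_def by eventually_elim auto
qed

lemma clipped_flow_deriv:
  assumes "clipped_flow \<epsilon> u v" "t \<in> {0..2 * pi}"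
  shows "(u has_real_derivative v t) (at t within {0..2 * pi})"
    "(v has_real_derivative - u t + \<epsilon> * h \<epsilon> (clip (v t))) (at t within {0..2 * pi})"
  using assms by (auto simp: clipped_flow_def)

lemma clipped_flow_box:
  assumes "small \<epsilon>" "clipped_flow \<epsilon> u v" and t: "t \<in> {0..2 * pi}"
  shows "\<bar>u t\<bar> \<le> 2 * V" "\<bar>v t\<bar> \<le> 2 * V" "V\<^sup>2 / 4 \<le> (u t)\<^sup>2 + (v t)\<^sup>2" "(u t)\<^sup>2 + (v t)\<^sup>2 < V\<^sup>2 + 1"
proof -
  have small: "\<epsilon> > 0" "K * \<epsilon> \<le> V / 2" "2 * (K * \<epsilon>)\<^sup>2 + 2 * V * (K * \<epsilon>) < 1" "K * \<epsilon> \<ge> 0"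
    using assms(1) K_nonneg by (auto simp: small_def)
  define p where "p = u t * cos t - v t * sin t"
  define q where "q = u t * sin t + v t * cos t"
  have pq: "\<bar>p\<bar> \<le> K * \<epsilon>" "\<bar>q - V\<bar> \<le> K * \<epsilon>"
    using rotating_frame_bounds[OF small(1) assms(2) t] by (simp_all add: p_def q_def)
  have one: "x * (sin t)\<^sup>2 + x * (cos t)\<^sup>2 = x" for x :: real
    by (metis distrib_left mult_1_right sin_cos_squared_add)
  have uv: "u t = p * cos t + q * sin t" "v t = q * cos t - p * sin t"
    using one[of "u t"] one[of "v t"] by (simp_all add: p_def q_def power2_eq_square algebra_simps)
  have "(u t)\<^sup>2 + (v t)\<^sup>2 = (p\<^sup>2 * (sin t)\<^sup>2 + p\<^sup>2 * (cos t)\<^sup>2) + (q\<^sup>2 * (sin t)\<^sup>2 + q\<^sup>2 * (cos t)\<^sup>2)"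
    unfolding uv by (simp add: power2_eq_square algebra_simps)
  then have E: "(u t)\<^sup>2 + (v t)\<^sup>2 = p\<^sup>2 + q\<^sup>2" by (simp only: one)
  have mult: "\<bar>a * b\<bar> \<le> \<bar>a\<bar>" if "\<bar>b\<bar> \<le> 1" for a b :: real
    using mult_left_mono[OF that abs_ge_zero[of a]] by (simp add: abs_mult)
  note m = mult[OF abs_cos_le_one[of t]] mult[OF abs_sin_le_one[of t]]
  show "\<bar>u t\<bar> \<le> 2 * V" "\<bar>v t\<bar> \<le> 2 * V"
    using m(1)[of p] m(2)[of q] m(1)[of q] m(2)[of p] pq small(2) unfolding uv by linarith+
  have "V / 2 \<le> q" using pq small(2) by linarith
  then have "(V / 2)\<^sup>2 \<le> q\<^sup>2" using V by (intro power_mono) auto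
  then have "V\<^sup>2 / 4 \<le> q\<^sup>2" by (simp add: power_divide)
  then show "V\<^sup>2 / 4 \<le> (u t)\<^sup>2 + (v t)\<^sup>2" unfolding E using zero_le_power2[of p] by linarith
  have "p\<^sup>2 \<le> (K * \<epsilon>)\<^sup>2" using power_mono[OF pq(1), of 2] by simp
  moreover have "q\<^sup>2 \<le> (V + K * \<epsilon>)\<^sup>2" using pq \<open>V / 2 \<le> q\<close> V by (intro power_mono) auto
  ultimately show "(u t)\<^sup>2 + (v t)\<^sup>2 < V\<^sup>2 + 1"
    unfolding E power2_sum using small(3) by (simp add: algebra_simps)
qed

lemma energy_gain:
  assumes small: "small \<epsilon>" and flow: "clipped_flow \<epsilon> u v" and s: "s \<in> {0..2 * pi}"
    and below: "\<And>t. t \<in> {0..s} \<Longrightarrow> v t \<le> V"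
  shows "W \<epsilon> (u 0) (v 0) + \<epsilon> * (\<kappa> * V\<^sup>2 / 16) * s \<le> W \<epsilon> (u s) (v s)"
proof (rule W_growth)
  fix t assume t: "t \<in> {0..s}"
  then have t': "t \<in> {0..2 * pi}" using s by auto
  note box = clipped_flow_box[OF small flow t']
  show "v t \<in> {- 2 * V..V}" using box(2) below[OF t] by auto
  then have "clip (v t) = v t" by (rule clip_id)
  then show "(v has_real_derivative - u t + \<epsilon> * h \<epsilon> (v t)) (at t within {0..s})"
    using DERIV_subset[OF clipped_flow_deriv(2)[OF flow t'], of "{0..s}"] s by auto
  show "(u has_real_derivative v t) (at t within {0..s})"
    using DERIV_subset[OF clipped_flow_deriv(1)[OF flow t'], of "{0..s}"] s by auto
  show "\<bar>u t\<bar> \<le> 2 * V" "V\<^sup>2 / 4 \<le> (u t)\<^sup>2 + (v t)\<^sup>2" using box by auto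
qed (use small s in \<open>auto simp: small_def\<close>)

text \<open>The correction vanishes with \<open>u\<close>, and \<open>u = O(\<epsilon>)\<close> at the beginning and at the end of a full turn.\<close>

lemma W_correction_bound:
  assumes "\<bar>u\<bar> \<le> 2 * V" "\<bar>v\<bar> \<le> 2 * V"
  shows "\<bar>u * (a0 + \<kappa> * v / 2 + \<beta> * (v\<^sup>2 + 2 * u\<^sup>2 / 3))\<bar> \<le> \<bar>u\<bar> * G0"
proof -
  have "\<bar>\<kappa> * v\<bar> \<le> \<kappa> * (2 * V)"
    unfolding abs_mult using assms \<kappa>_pos by (intro mult_mono) auto
  moreover have "u\<^sup>2 \<le> 4 * V\<^sup>2" "v\<^sup>2 \<le> 4 * V\<^sup>2"
    using power_mono[OF assms(1), of 2] power_mono[OF assms(2), of 2] by (simp_all add: power_mult_distrib)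
  then have "v\<^sup>2 + 2 * u\<^sup>2 / 3 \<le> 7 * V\<^sup>2" using zero_le_power2[of V] by linarith
  then have "\<beta> * (v\<^sup>2 + 2 * u\<^sup>2 / 3) \<le> \<beta> * (7 * V\<^sup>2)" using \<beta> by (intro mult_left_mono) auto
  moreover have "\<beta> * (v\<^sup>2 + 2 * u\<^sup>2 / 3) \<ge> 0" using \<beta> by simp
  ultimately have "\<bar>a0 + \<kappa> * v / 2 + \<beta> * (v\<^sup>2 + 2 * u\<^sup>2 / 3)\<bar> \<le> G0"
    unfolding G0_def by simp
  then show ?thesis unfolding abs_mult by (intro mult_left_mono) auto
qed

text \<open>If the orbit stayed below the line for a whole turn, it would gain energy of order \<open>\<epsilon>\<close>, while at the
  end of the turn \<open>u\<^sup>2\<close> is only of order \<open>\<epsilon>\<^sup>2\<close>; so the gain would have to show up in \<open>v\<close>, above \<open>V\<close>.\<close>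

lemma overshoot:
  assumes small: "small \<epsilon>" and flow: "clipped_flow \<epsilon> u v"
  shows "\<exists>t\<in>{0..2 * pi}. v t > V"
proof (rule ccontr)
  assume "\<not> ?thesis"
  then have below: "v t \<le> V" if "t \<in> {0..2 * pi}" for t using that by force
  let ?T = "2 * pi" and ?k = "\<epsilon> * (\<kappa> * V\<^sup>2 / 16)"
  let ?C = "\<lambda>u v. u * (a0 + \<kappa> * v / 2 + \<beta> * (v\<^sup>2 + 2 * u\<^sup>2 / 3))"
  have eps: "\<epsilon> > 0" and gain: "\<epsilon> * (4 * K * G0 + K\<^sup>2) < 4 * pi * (\<kappa> * V\<^sup>2 / 16)"
    using small by (auto simp: small_def)
  have T: "?T \<in> {0..?T}" "0 \<in> {0..?T}" by auto
  have init: "u 0 = - \<epsilon> * c * V" "v 0 = V" using flow by (auto simp: clipped_flow_def)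
  have G0: "G0 \<ge> 0" using \<kappa>_pos V \<beta> by (simp add: G0_def)
  have u: "\<bar>u 0\<bar> \<le> K * \<epsilon>" "\<bar>u ?T\<bar> \<le> K * \<epsilon>"
    using rotating_frame_bounds(1)[OF eps flow T(1)] rotating_frame_bounds(1)[OF eps flow T(2)] by simp_all
  have C: "\<bar>?C (u t) (v t)\<bar> \<le> K * \<epsilon> * G0" if "t \<in> {0..?T}" "\<bar>u t\<bar> \<le> K * \<epsilon>" for t
    using W_correction_bound[OF clipped_flow_box(1,2)[OF small flow that(1)]]
      mult_right_mono[OF that(2) G0] by linarith
  have "\<epsilon> * \<bar>?C (u 0) (v 0)\<bar> \<le> \<epsilon> * (K * \<epsilon> * G0)" "\<epsilon> * \<bar>?C (u ?T) (v ?T)\<bar> \<le> \<epsilon> * (K * \<epsilon> * G0)"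
    using C[OF T(1) u(2)] C[OF T(2) u(1)] eps by (intro mult_left_mono; simp)+
  moreover have "\<epsilon> * \<bar>x\<bar> = \<bar>\<epsilon> * x\<bar>" for x using eps by (simp add: abs_mult)
  ultimately have eC: "\<bar>\<epsilon> * ?C (u 0) (v 0)\<bar> \<le> \<epsilon> * (K * \<epsilon> * G0)" "\<bar>\<epsilon> * ?C (u ?T) (v ?T)\<bar> \<le> \<epsilon> * (K * \<epsilon> * G0)"
    by simp_all
  have "W \<epsilon> (u 0) (v 0) + ?k * ?T \<le> W \<epsilon> (u ?T) (v ?T)"
    by (rule energy_gain[OF small flow T(1) below])
  moreover have "A + k - 2 * D \<le> B" if "A - x + k \<le> B - y" "\<bar>x\<bar> \<le> D" "\<bar>y\<bar> \<le> D" for A B D k x y :: real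
    using that by linarith
  ultimately have "((u 0)\<^sup>2 + (v 0)\<^sup>2) / 2 + ?k * ?T - 2 * (\<epsilon> * (K * \<epsilon> * G0)) \<le> ((u ?T)\<^sup>2 + (v ?T)\<^sup>2) / 2"
    using eC unfolding W_def by blast
  moreover have "\<epsilon> * (\<epsilon> * (4 * K * G0 + K\<^sup>2)) < \<epsilon> * (4 * pi * (\<kappa> * V\<^sup>2 / 16))"
    using gain eps by (rule mult_strict_left_mono)
  then have "4 * (\<epsilon> * (K * \<epsilon> * G0)) + (K * \<epsilon>)\<^sup>2 < 2 * (?k * ?T)"
    by (simp add: power2_eq_square algebra_simps)
  moreover have "(u ?T)\<^sup>2 \<le> (K * \<epsilon>)\<^sup>2" using power_mono[OF u(2), of 2] by simp
  moreover have "b < b'" if "(a + b) / 2 + k - 2 * D \<le> (a' + b') / 2" "4 * D + q < 2 * k" "a' \<le> q" "0 \<le> a"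
    for a b a' b' k D q :: real using that by (simp add: field_simps)
  ultimately have "(v 0)\<^sup>2 < (v ?T)\<^sup>2"
    using zero_le_power2[of "u 0"] by blast
  moreover have "\<bar>v ?T - V\<bar> \<le> K * \<epsilon>" "K * \<epsilon> \<le> V / 2"
    using rotating_frame_bounds(2)[OF eps flow T(1)] small by (simp_all add: small_def)
  then have "0 \<le> v ?T" using V by linarith
  ultimately have "V < v ?T" using V init(2) by (simp add: power2_less_imp_less)
  then show False using below[OF T(1)] by simp
qed

text \<open>At the starting point \<open>v' = 0\<close> and \<open>v'' = - V\<close>: the orbit leaves the line tangentially, downward.\<close>

lemma departs_downward:
  assumes eps: "\<epsilon> > 0" and flow: "clipped_flow \<epsilon> u v"
  obtains d where "0 < d" "d < 2 * pi" "\<And>t. 0 < t \<Longrightarrow> t < d \<Longrightarrow> v t < V"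
proof -
  let ?I = "{0..2 * pi}"
  have 0: "0 \<in> ?I" by auto
  define g where "g = (\<lambda>t. - u t + \<epsilon> * h \<epsilon> (clip (v t)))"
  have dv: "(v has_real_derivative g t) (at t within ?I)" if "t \<in> ?I" for t
    using flow that by (simp add: clipped_flow_def g_def)
  have du: "(u has_real_derivative V) (at 0 within ?I)"
    using flow 0 by (auto simp: clipped_flow_def)
  have "clip V = V" using V by (simp add: clip_def)
  then have g0: "g 0 = 0" using flow by (simp add: clipped_flow_def g_def h_V)
  obtain L where L: "L \<ge> 0" "\<And>v w. \<bar>h \<epsilon> (clip v) - h \<epsilon> (clip w)\<bar> \<le> L * \<bar>v - w\<bar>"
    using clipped_h_lipschitz[OF eps] by blast
  \<comment> \<open>Clipping has a corner at \<open>V\<close>, but a Lipschitz function of \<open>v\<close> is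
    differentiable at 0 because \<open>v\<close> is stationary there.\<close>
  have "((\<lambda>t. h \<epsilon> (clip (v t))) has_real_derivative 0) (at 0 within ?I)"
    unfolding has_field_derivative_def has_derivative_within_alt
  proof (intro conjI allI impI)
    fix e :: real assume "e > 0"
    then have e: "e / (L + 1) > 0" using L(1) by simp
    obtain d where d: "d > 0" "\<And>t. t \<in> ?I \<Longrightarrow> norm (t - 0) < d \<Longrightarrow>
        norm (v t - v 0 - 0 * (t - 0)) \<le> e / (L + 1) * norm (t - 0)"
      using dv[OF 0] e unfolding g0 has_field_derivative_def has_derivative_within_alt by blast
    have "norm (h \<epsilon> (clip (v t)) - h \<epsilon> (clip (v 0)) - 0 * (t - 0)) \<le> e * norm (t - 0)"
      if "t \<in> ?I" "norm (t - 0) < d" for t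
    proof -
      have "\<bar>h \<epsilon> (clip (v t)) - h \<epsilon> (clip (v 0))\<bar> \<le> L * \<bar>v t - v 0\<bar>" by (rule L(2))
      also have "\<dots> \<le> (L + 1) * (e / (L + 1) * \<bar>t\<bar>)"
        using d(2)[OF that] L(1) by (intro mult_mono) auto
      also have "\<dots> = e * \<bar>t\<bar>" using L(1) by simp
      finally show ?thesis by simp
    qed
    then show "\<exists>d>0. \<forall>t\<in>?I. norm (t - 0) < d \<longrightarrow>
        norm (h \<epsilon> (clip (v t)) - h \<epsilon> (clip (v 0)) - 0 * (t - 0)) \<le> e * norm (t - 0)"
      using d(1) by blast
  qed (rule bounded_linear_mult_right)
  then have "(g has_real_derivative - V + \<epsilon> * 0) (at 0 within ?I)"
    unfolding g_def by (intro DERIV_add DERIV_minus du DERIV_cmult)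
  then have "(g has_real_derivative - V) (at 0 within ?I)" by simp
  then obtain d where d: "d > 0" "\<And>t. 0 < t \<Longrightarrow> t \<in> ?I \<Longrightarrow> t < d \<Longrightarrow> g t < g 0"
    using has_real_derivative_neg_dec_right[of g "- V" 0 ?I] V by auto
  show thesis
  proof (rule that[of "min d pi"])
    fix t assume t: "0 < t" "t < min d pi"
    have "\<exists>s\<in>{0<..<t}. v t - v 0 = (\<lambda>x. g s * x) (t - 0)"
    proof (rule mvt_simple[OF t(1)])
      fix s assume "0 \<le> s" "s \<le> t"
      then have "s \<in> ?I" "{0..t} \<subseteq> ?I" using t pi_gt_zero by auto
      then show "(v has_derivative (\<lambda>x. g s * x)) (at s within {0..t})"
        using DERIV_subset[OF dv] by (simp add: has_field_derivative_def)
    qed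
    then obtain s where s: "s \<in> {0<..<t}" "v t - v 0 = g s * t" by auto
    then have "g s < 0" using d(2)[of s] t g0 by auto
    then have "g s * t < 0" using t(1) by (rule mult_neg_pos)
    then show "v t < V" using s(2) flow by (simp add: clipped_flow_def)
  qed (use d pi_gt_zero in \<open>auto simp: min_def\<close>)
qed

text \<open>At the first return to the line \<open>v\<close> cannot be decreasing, which puts the point weakly to the left
  of the starting point. It is strictly to the left because \<open>W\<close> has increased.\<close>

lemma stick_slip_arc:
  assumes small: "small \<epsilon>"
  obtains \<tau> u v where "\<tau> > 0" "u 0 = - \<epsilon> * c * V" "v 0 = V"
    "\<And>t. t \<in> {0..\<tau>} \<Longrightarrow> (u has_real_derivative v t) (at t within {0..\<tau>})"
    "\<And>t. t \<in> {0..\<tau>} \<Longrightarrow> (v has_real_derivative - u t + \<epsilon> * h \<epsilon> (v t)) (at t within {0..\<tau>})"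
    "\<And>t. t \<in> {0..\<tau>} \<Longrightarrow> \<bar>u t\<bar> \<le> 2 * V" "\<And>t. t \<in> {0..\<tau>} \<Longrightarrow> v t \<in> {- 2 * V..V}"
    "\<And>t. 0 < t \<Longrightarrow> t < \<tau> \<Longrightarrow> v t < V" "v \<tau> = V" "u \<tau> < - \<epsilon> * c * V" "\<bar>u \<tau>\<bar> < 1"
proof -
  have eps: "\<epsilon> > 0" using small by (simp add: small_def)
  obtain u v where flow: "clipped_flow \<epsilon> u v" using clipped_flow_exists[OF eps] by blast
  have init: "u 0 = - \<epsilon> * c * V" "v 0 = V" using flow by (auto simp: clipped_flow_def)
  have contv: "continuous_on {0..2 * pi} v"
    using clipped_flow_deriv(2)[OF flow] by (rule DERIV_continuous_on)
  obtain d where d: "0 < d" "d < 2 * pi" "\<And>t. 0 < t \<Longrightarrow> t < d \<Longrightarrow> v t < V"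
    using departs_downward[OF eps flow] by blast
  obtain t1 where t1: "t1 \<in> {0..2 * pi}" "v t1 > V" using overshoot[OF small flow] by blast
  have "d \<le> t1" using d(3)[of t1] t1 init(2) by (cases "t1 = 0") force+
  \<comment> \<open>The first return is sought on \<open>{b..t1}\<close>, so that the initial contact at time
    0 is excluded.\<close>
  define b where "b = d / 2"
  have b: "0 < b" "b < d" "v b < V" using d by (auto simp: b_def)
  have cont_b: "continuous_on {b..t} v" if "t \<le> t1" for t
    using contv by (rule continuous_on_subset) (use b t1 that in auto)
  define A where "A = {t \<in> {b..t1}. v t = V}"
  have "A \<noteq> {}"
    using IVT'[of v b V t1] b t1 \<open>d \<le> t1\<close> cont_b[of t1] by (auto simp: A_def)
  moreover have "compact A"
  proof -
    have "closed ({b..t1} \<inter> v -` {V})"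
      using cont_b[of t1] by (intro continuous_closed_preimage) auto
    moreover have "{b..t1} \<inter> v -` {V} = A" by (auto simp: A_def)
    ultimately have "closed A" by simp
    then show ?thesis by (rule compact_eq_bounded_closed[THEN iffD2, OF conjI, rotated])
      (rule bounded_subset[of "{b..t1}"], auto simp: A_def)
  qed
  ultimately obtain \<tau> where \<tau>: "\<tau> \<in> A" "\<And>t. t \<in> A \<Longrightarrow> \<tau> \<le> t"
    using compact_attains_inf[of A] by blast
  have \<tau>0: "0 < \<tau>" "\<tau> \<in> {0..2 * pi}" "v \<tau> = V" "\<tau> \<le> t1" "b \<le> \<tau>"
    using \<tau>(1) b t1 by (auto simp: A_def)
  have below: "v t < V" if t: "0 < t" "t < \<tau>" for t
  proof (cases "t < d")
    case False
    show ?thesis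
    proof (rule ccontr)
      assume "\<not> v t < V"
      then have "\<exists>s\<ge>b. s \<le> t \<and> v s = V"
        using IVT'[of v b V t] b False t \<tau>0 cont_b[of t] by auto
      then have "\<exists>s\<in>A. s \<le> t" using t \<tau>0 by (auto simp: A_def)
      then show False using \<tau>(2) t by force
    qed
  qed (use d t in auto)
  then have le: "v t \<le> V" if "t \<in> {0..\<tau>}" for t
    using that init(2) \<tau>0(3) by (cases "t = 0 \<or> t = \<tau>") (auto simp: less_imp_le)
  have sub: "{0..\<tau>} \<subseteq> {0..2 * pi}" using \<tau>0 by auto
  have box: "\<bar>u t\<bar> \<le> 2 * V" "v t \<in> {- 2 * V..V}" if "t \<in> {0..\<tau>}" for t
    using clipped_flow_box(1,2)[OF small flow] sub le[OF that] that by (fastforce simp: abs_le_iff)+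
  have du: "(u has_real_derivative v t) (at t within {0..\<tau>})" if "t \<in> {0..\<tau>}" for t
    by (rule DERIV_subset[OF clipped_flow_deriv(1)[OF flow] sub]) (use that sub in auto)
  have dv: "(v has_real_derivative - u t + \<epsilon> * h \<epsilon> (v t)) (at t within {0..\<tau>})" if "t \<in> {0..\<tau>}" for t
    by (rule DERIV_subset[OF clipped_flow_deriv(2)[OF flow, of t, unfolded clip_id[OF box(2)[OF that]]] sub])
      (use that sub in auto)
  \<comment> \<open>The left-hand side is the derivative of \<open>v\<close> at the return.\<close>
  have "- u \<tau> + \<epsilon> * h \<epsilon> V \<ge> 0"
  proof (rule ccontr)
    assume "\<not> ?thesis"
    then obtain e where e: "e > 0" "\<And>s. 0 < s \<Longrightarrow> \<tau> - s \<in> {0..\<tau>} \<Longrightarrow> s < e \<Longrightarrow> v \<tau> < v (\<tau> - s)"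
      using has_real_derivative_neg_dec_left[of v _ \<tau> "{0..\<tau>}"] dv[of \<tau>] \<tau>0 by fastforce
    define s where "s = min (e / 2) \<tau>"
    have "0 < s" "s \<le> \<tau>" "s < e" using e(1) \<tau>0(1) by (auto simp: s_def min_def)
    then show False using e(2)[of s] le[of "\<tau> - s"] \<tau>0(3) by auto
  qed
  then have "u \<tau> \<le> u 0" by (simp add: h_V init)
  moreover have "u \<tau> \<noteq> u 0"
  proof
    assume "u \<tau> = u 0"
    moreover have "W \<epsilon> (u 0) (v 0) + \<epsilon> * (\<kappa> * V\<^sup>2 / 16) * \<tau> \<le> W \<epsilon> (u \<tau>) (v \<tau>)"
      by (rule energy_gain[OF small flow \<tau>0(2) le])
    moreover have "\<epsilon> * (\<kappa> * V\<^sup>2 / 16) * \<tau> > 0" using eps \<kappa>_pos V \<tau>0(1) by simp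
    ultimately show False using init(2) \<tau>0(3) by simp
  qed
  moreover have "\<bar>u \<tau>\<bar> < 1"
    using clipped_flow_box(4)[OF small flow \<tau>0(2)] \<tau>0(3) by (simp add: abs_square_less_1)
  ultimately show thesis
    using init(1) by (intro that[OF \<tau>0(1) init du dv box below \<tau>0(3)]) auto
qed

section \<open>The stick-slip cycle\<close>


lemma slip_vector_in_filippov_map:
  assumes "\<epsilon> > 0" "v < V"
  shows "(v, - u + \<epsilon> * h \<epsilon> v) \<in> filippov_map V (stribeck_oscillator \<alpha> \<beta> \<gamma> V c \<epsilon>) (1 + u, v)"
  using assms h_eq_friction[OF assms(1), of v]
  by (simp add: filippov_map_oscillator_off_line sgn_if abs_if)

lemma stick_vector_in_filippov_map:
  assumes "- 1 - \<epsilon> * c * V \<le> s" "s \<le> 1 - \<epsilon> * c * V"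
  shows "(V, 0) \<in> filippov_map V (stribeck_oscillator \<alpha> \<beta> \<gamma> V c \<epsilon>) (s, V)"
  unfolding filippov_map_oscillator_on_line
  using assms by (intro exI[of _ "- s - \<epsilon> * c * V"]) (auto simp: abs_le_iff)

text \<open>The slip arc followed by uniform sliding, at belt speed \<open>V\<close>, from its return point \<open>\<xi>\<close> to the end of
  the sliding segment.\<close>

lemma stick_slip_orbit:
  assumes small: "small \<epsilon>"
  obtains X T \<tau> \<xi> where "filippov_solution_on V (stribeck_oscillator \<alpha> \<beta> \<gamma> V c \<epsilon>) UNIV X"
    "0 < \<tau>" "\<tau> < T" "\<And>t. X (t + T) = X t" "X 0 = (1 - \<epsilon> * c * V, V)" "snd (X (\<tau> / 2)) < V"
    "0 < \<xi>" "\<xi> < 1 - \<epsilon> * c * V" "V * (T - \<tau>) = 1 - \<epsilon> * c * V - \<xi>"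
    "\<And>t. t \<in> {\<tau>..T} \<Longrightarrow> X t = (\<xi> + V * (t - \<tau>), V)"
proof -
  let ?f = "stribeck_oscillator \<alpha> \<beta> \<gamma> V c \<epsilon>"
  have eps: "\<epsilon> > 0" "\<bar>c\<bar> * V * \<epsilon> < 1" using small by (auto simp: small_def)
  have "\<bar>\<epsilon> * c * V\<bar> = \<bar>c\<bar> * V * \<epsilon>" using eps(1) V by (simp add: abs_mult)
  then have cV: "\<bar>\<epsilon> * c * V\<bar> < 1" using eps(2) by simp
  obtain \<tau> u v where arc: "\<tau> > 0" "u 0 = - \<epsilon> * c * V" "v 0 = V"
    "\<And>t. t \<in> {0..\<tau>} \<Longrightarrow> (u has_real_derivative v t) (at t within {0..\<tau>})"
    "\<And>t. t \<in> {0..\<tau>} \<Longrightarrow> (v has_real_derivative - u t + \<epsilon> * h \<epsilon> (v t)) (at t within {0..\<tau>})"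
    "\<And>t. t \<in> {0..\<tau>} \<Longrightarrow> \<bar>u t\<bar> \<le> 2 * V" "\<And>t. t \<in> {0..\<tau>} \<Longrightarrow> v t \<in> {- 2 * V..V}"
    "\<And>t. 0 < t \<Longrightarrow> t < \<tau> \<Longrightarrow> v t < V" "v \<tau> = V" "u \<tau> < - \<epsilon> * c * V" "\<bar>u \<tau>\<bar> < 1"
    using stick_slip_arc[OF small] by metis
  define \<xi> where "\<xi> = 1 + u \<tau>"
  define T where "T = \<tau> + (1 - \<epsilon> * c * V - \<xi>) / V"
  define z1 where "z1 = (\<lambda>t. (1 + u t, v t))"
  define z2 where "z2 = (\<lambda>t. (\<xi> + V * (t - \<tau>), V))"
  define Z where "Z = (\<lambda>t. if t \<le> \<tau> then z1 t else z2 t)"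
  have \<xi>: "0 < \<xi>" "\<xi> < 1 - \<epsilon> * c * V" using arc(10,11) by (auto simp: \<xi>_def)
  then have T: "\<tau> < T" "V * (T - \<tau>) = 1 - \<epsilon> * c * V - \<xi>" using V by (auto simp: T_def)
  have d1: "(z1 has_vector_derivative (v t, - u t + \<epsilon> * h \<epsilon> (v t))) (at t within {0..\<tau>})"
    if t: "t \<in> {0..\<tau>}" for t
  proof -
    have "((\<lambda>t. 1 + u t) has_vector_derivative v t) (at t within {0..\<tau>})"
      using arc(4)[OF t] by (auto intro!: derivative_eq_intros simp flip: has_real_derivative_iff_has_vector_derivative)
    then show ?thesis
      unfolding z1_def using arc(5)[OF t]
      by (intro has_vector_derivative_Pair) (auto simp: has_real_derivative_iff_has_vector_derivative)
  qed
  have d2: "(z2 has_vector_derivative (V, 0)) (at t within A)" for t A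
    unfolding z2_def
    by (intro has_vector_derivative_Pair)
      (auto intro!: derivative_eq_intros simp flip: has_real_derivative_iff_has_vector_derivative)
  define B where "B = 4 * V + \<epsilon> * M"
  have B: "V \<le> B" "0 \<le> B" using V eps(1) M_nonneg by (simp_all add: B_def)
  have lip: "B-lipschitz_on {0..T} Z"
    unfolding Z_def
  proof (rule lipschitz_on_concat)
    show "B-lipschitz_on {0..\<tau>} z1"
    proof (rule lipschitz_on_of_derivative_bound[OF d1 _ B(2)])
      fix t assume t: "t \<in> {0..\<tau>}"
      have "\<bar>v t\<bar> \<le> 2 * V" using arc(7)[OF t] by auto
      moreover have "\<bar>- u t + \<epsilon> * h \<epsilon> (v t)\<bar> \<le> 2 * V + \<epsilon> * M"
      proof -
        have "\<bar>\<epsilon> * h \<epsilon> (v t)\<bar> \<le> \<epsilon> * M"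
          using h_bound[OF eps(1) arc(7)[OF t]] eps(1) by (simp add: abs_mult)
        then show ?thesis using arc(6)[OF t] by linarith
      qed
      moreover have "norm (v t, - u t + \<epsilon> * h \<epsilon> (v t)) \<le> \<bar>v t\<bar> + \<bar>- u t + \<epsilon> * h \<epsilon> (v t)\<bar>"
        using norm_Pair_le[of "v t" "- u t + \<epsilon> * h \<epsilon> (v t)"] by simp
      ultimately show "norm (v t, - u t + \<epsilon> * h \<epsilon> (v t)) \<le> B" by (simp add: B_def)
    qed
    show "B-lipschitz_on {\<tau>..T} z2"
      by (rule lipschitz_on_of_derivative_bound[OF d2 _ B(2)]) (use B V in \<open>simp add: norm_Pair\<close>)
    show "z1 \<tau> = z2 \<tau>" using arc(9) by (simp add: z1_def z2_def \<xi>_def)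
  qed
  have closed: "Z T = Z 0"
    using T arc(1,2,3) by (simp add: Z_def z1_def z2_def)
  have deriv: "\<exists>w\<in>filippov_map V ?f (Z t). (Z has_vector_derivative w) (at t)"
    if t: "t \<in> {0<..<T} - {\<tau>}" for t
  proof (cases "t < \<tau>")
    case True
    have "(z1 has_vector_derivative (v t, - u t + \<epsilon> * h \<epsilon> (v t))) (at t)"
      using d1[of t] t True by (simp add: at_within_Icc_at)
    then have "(Z has_vector_derivative (v t, - u t + \<epsilon> * h \<epsilon> (v t))) (at t)"
      by (rule has_vector_derivative_transform_within_open[of _ _ _ "{..<\<tau>}"]) (use True in \<open>auto simp: Z_def\<close>)
    moreover have "(v t, - u t + \<epsilon> * h \<epsilon> (v t)) \<in> filippov_map V ?f (Z t)"
      using slip_vector_in_filippov_map[OF eps(1) arc(8)] t True by (simp add: Z_def z1_def)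
    ultimately show ?thesis by blast
  next
    case False
    then have \<tau>t: "\<tau> < t" "t < T" using t by auto
    have "(Z has_vector_derivative (V, 0)) (at t)"
      by (rule has_vector_derivative_transform_within_open[OF d2, of "{\<tau><..}"]) (use \<tau>t in \<open>auto simp: Z_def\<close>)
    moreover have "(V, 0) \<in> filippov_map V ?f (Z t)"
    proof -
      have "0 \<le> V * (t - \<tau>)" "V * (t - \<tau>) \<le> V * (T - \<tau>)" using V \<tau>t by auto
      then have "- 1 - \<epsilon> * c * V \<le> \<xi> + V * (t - \<tau>)" "\<xi> + V * (t - \<tau>) \<le> 1 - \<epsilon> * c * V"
        using \<xi> cV T(2) by linarith+
      then show ?thesis
        using \<tau>t stick_vector_in_filippov_map by (simp add: Z_def z2_def)
    qed
    ultimately show ?thesis by blast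
  qed
  have "T > 0" using arc(1) T(1) by simp
  from periodic_extension[where S = "{\<tau>}", OF this lip closed _ deriv]
  obtain X where X: "filippov_solution_on V ?f UNIV X" "\<And>t. X (t + T) = X t"
    "\<And>t. t \<in> {0..T} \<Longrightarrow> X t = Z t"
    by auto
  show thesis
  proof (rule that[OF X(1) arc(1) T(1) X(2) _ _ \<xi> T(2)])
    show "X 0 = (1 - \<epsilon> * c * V, V)"
      using X(3)[of 0] arc(1,2,3) T(1) by (simp add: Z_def z1_def)
    show "snd (X (\<tau> / 2)) < V"
      using X(3)[of "\<tau> / 2"] arc(1) arc(8)[of "\<tau> / 2"] T(1) by (simp add: Z_def z1_def)
    show "X t = (\<xi> + V * (t - \<tau>), V)" if "t \<in> {\<tau>..T}" for t
      using X(3)[of t] that arc(1,9) by (auto simp: Z_def z1_def z2_def \<xi>_def)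
  qed
qed

text \<open>The uniform sliding margin \<open>m\<close> needs distance from the right end of the segment, where sliding
  becomes marginal; hence only the first three quarters of the sliding piece, of length \<open>w\<close>, are
  used as target, and the second quarter as the window in which neighbours are captured.\<close>

lemma stick_slip_limit_cycle_exists:
  assumes small: "small \<epsilon>"
  shows "\<exists>C. limit_cycle V (stribeck_oscillator \<alpha> \<beta> \<gamma> V c \<epsilon>) C \<and>
    stick_slip V (stribeck_oscillator \<alpha> \<beta> \<gamma> V c \<epsilon>) C \<and>
    finite_time_stable V (stribeck_oscillator \<alpha> \<beta> \<gamma> V c \<epsilon>) C \<and>
    (1 - \<epsilon> * c * V, V) \<in> C"
proof -
  let ?f = "stribeck_oscillator \<alpha> \<beta> \<gamma> V c \<epsilon>"
  obtain X T \<tau> \<xi> where X: "filippov_solution_on V ?f UNIV X"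
    "0 < \<tau>" "\<tau> < T" "\<And>t. X (t + T) = X t" "X 0 = (1 - \<epsilon> * c * V, V)" "snd (X (\<tau> / 2)) < V"
    and \<xi>: "0 < \<xi>" "\<xi> < 1 - \<epsilon> * c * V" "V * (T - \<tau>) = 1 - \<epsilon> * c * V - \<xi>"
    and stick: "\<And>t. t \<in> {\<tau>..T} \<Longrightarrow> X t = (\<xi> + V * (t - \<tau>), V)"
    using stick_slip_orbit[OF small] by metis
  have eps: "\<epsilon> > 0" "\<bar>c\<bar> * V * \<epsilon> < 1" using small by (auto simp: small_def)
  have "\<bar>\<epsilon> * c * V\<bar> = \<bar>c\<bar> * V * \<epsilon>" using eps(1) V by (simp add: abs_mult)
  then have cV: "\<bar>\<epsilon> * c * V\<bar> < 1" using eps(2) by simp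
  define w where "w = 1 - \<epsilon> * c * V - \<xi>"
  define m where "m = min (w / 4) (1 + \<epsilon> * c * V + \<xi>)"
  have w: "w > 0" using \<xi> by (simp add: w_def)
  have m: "m > 0" using w \<xi>(1) cV by (auto simp: m_def)
  obtain L where osl: "one_sided_lipschitz L (filippov_map V ?f)"
    using one_sided_lipschitz_oscillator[OF eps(1) \<beta> \<gamma>] by blast
  have seg: "(s, V) \<in> range X" if "s \<in> {\<xi>..\<xi> + 3 * w / 4}" for s
  proof -
    have "V * ((s - \<xi>) / V) = s - \<xi>" using V by simp
    moreover have "s - \<xi> \<le> V * (T - \<tau>)" using that w unfolding \<xi>(3) w_def[symmetric] by auto
    then have "(s - \<xi>) / V \<le> T - \<tau>" using V by (simp add: pos_divide_le_eq mult.commute)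
    moreover have "0 \<le> (s - \<xi>) / V" using that V by simp
    ultimately have "X (\<tau> + (s - \<xi>) / V) = (s, V)" by (subst stick) auto
    then show ?thesis by (metis rangeI)
  qed
  have nonconst: "\<not> X constant_on UNIV"
  proof
    assume "X constant_on UNIV"
    then have "X (\<tau> / 2) = X 0" unfolding constant_on_def by auto
    then show False using X(5,6) by simp
  qed
  have slide: "m \<le> snd (lower_limit V ?f s)" "snd (upper_limit V ?f s) \<le> - m"
    if "s \<in> {\<xi>..\<xi> + 3 * w / 4}" for s
  proof -
    have "1 - \<epsilon> * c * V = w + \<xi>" by (simp add: w_def)
    moreover have "m \<le> w / 4" "m \<le> 1 + \<epsilon> * c * V + \<xi>"
      unfolding m_def by (rule min.cobounded1, rule min.cobounded2)
    moreover have "\<xi> \<le> s" "s \<le> \<xi> + 3 * w / 4" using that by auto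
    ultimately show "m \<le> snd (lower_limit V ?f s)" "snd (upper_limit V ?f s) \<le> - m"
      unfolding lower_limit_oscillator upper_limit_oscillator snd_conv by linarith+
  qed
  have window: "snd (X t) = V \<and> fst (X t) \<in> {\<xi> + w / 4..\<xi> + 3 * w / 4 - w / 4}"
    if t: "t \<in> {\<tau> + w / (4 * V)..\<tau> + w / (2 * V)}" for t
  proof -
    have "T - \<tau> = w / V" using \<xi>(3) V unfolding w_def by (simp add: field_simps)
    moreover have "w / (2 * V) \<le> w / V" using w V by (intro divide_left_mono) auto
    moreover have "0 \<le> w / (4 * V)" using w V by simp
    ultimately have "t \<in> {\<tau>..T}" using t by auto
    moreover have "V * (w / (4 * V)) \<le> V * (t - \<tau>)" "V * (t - \<tau>) \<le> V * (w / (2 * V))"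
      using t V by (intro mult_left_mono; simp)+
    then have "w / 4 \<le> V * (t - \<tau>)" "V * (t - \<tau>) \<le> w / 2" using V by simp_all
    ultimately show ?thesis by (simp add: stick)
  qed
  have "w / (4 * V) < w / (2 * V)" using w V by (simp add: divide_strict_left_mono)
  then have interval: "\<tau> + w / (4 * V) < \<tau> + w / (2 * V)" "w / 4 > 0" "T > 0" using w X(2,3) by auto
  note cycle = sliding_orbit_stable_limit_cycle[OF osl X(1) interval(3) X(4) nonconst m slide seg interval(1,2)
      window[THEN conjunct1] window[THEN conjunct2]]
  have "limit_cycle V ?f (range X)" "finite_time_stable V ?f (range X)"
    by (rule cycle; assumption)+
  moreover have "stick_slip V ?f (range X)"
    unfolding stick_slip_def
  proof (intro conjI)
    have "sliding_point V ?f (s, V)" if "s \<in> {\<xi>..\<xi> + 3 * w / 4}" for s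
      using slide[OF that] m by (simp add: sliding_point_def)
    then show "\<exists>a b. a < b \<and> (\<forall>s\<in>{a..b}. (s, V) \<in> range X \<and> sliding_point V ?f (s, V))"
      using seg w by (intro exI[of _ \<xi>] exI[of _ "\<xi> + 3 * w / 4"]) auto
    show "\<exists>p\<in>range X. snd p \<noteq> V" using X(6) by auto
  qed
  moreover have "(1 - \<epsilon> * c * V, V) \<in> range X" using X(5) by (metis rangeI)
  ultimately show ?thesis by blast
qed

end

theorem proposition3:
  fixes \<alpha> \<beta> \<gamma> V c :: real
  assumes "\<alpha> > 0" "\<beta> > 0" "\<gamma> > 0" "V > 0"
    and "- c + \<gamma> * (1 - \<alpha>) - 2 * \<beta> * V > 0"
  shows "\<exists>\<epsilon>0>0. \<forall>\<epsilon>. 0 < \<epsilon> \<and> \<epsilon> < \<epsilon>0 \<longrightarrow>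
    (\<exists>C. limit_cycle V (stribeck_oscillator \<alpha> \<beta> \<gamma> V c \<epsilon>) C \<and>
         stick_slip V (stribeck_oscillator \<alpha> \<beta> \<gamma> V c \<epsilon>) C \<and>
         finite_time_stable V (stribeck_oscillator \<alpha> \<beta> \<gamma> V c \<epsilon>) C \<and>
         (1 - \<epsilon> * c * V, V) \<in> C)"
proof -
  interpret stribeck \<alpha> \<beta> \<gamma> V c by unfold_locales (fact assms)+
  obtain \<epsilon>0 where "\<epsilon>0 > 0" "\<And>\<epsilon>. 0 < \<epsilon> \<Longrightarrow> \<epsilon> < \<epsilon>0 \<Longrightarrow> small \<epsilon>"
    using eventually_small unfolding eventually_at_right_field by blast
  then show ?thesis using stick_slip_limit_cycle_exists by blast
qed

end
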